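(* Let $(Z_n)_{n\ge 0}$ be a branching process in a stationary and ergodic random environment $\xi=(\xi_0,\xi_1,\dots)$, which is supercritical in the sense that $\mathbb{E}\log m_0\in(0,\infty)$. Let $W_n=Z_n/\Pi_n$ and $W=\lim_{n\to\infty}W_n$ a.s. Let $p\in(1,2)$ and let $q$ be defined by $1/p+1/q=1$. If $\mathbb{E}\log\mathbb{E}_\xi\left(\frac{Z_1}{m_0}\right)^p<\infty$, then for every $\varepsilon>0$, as $n\to\infty$, $$W-W_n=o\left(m^{-\frac{n}{q+\varepsilon}}\right)\quad\text{a.s.},$$ where $m=\exp(\mathbb{E}\log m_0)>1$.
   Context: Branching process in a random environment: $\xi=(\xi_0,\xi_1,\xi_2,\dots)$ is a stationary and ergodic sequence of random variables. Each realization of $\xi_n$ corresponds to a probability distribution $p(\xi_n)=\{p_i(\xi_n): i\in\mathbb{N}_0\}$ on $\mathbb{N}_0=\{0,1,2,\dots\}$ (so $p_i(\xi_n)\ge0$, $\sum_i p_i(\xi_n)=1$) with $\sum_i i\,p_i(\xi_n)\in(0,\infty)$. The process is defined by $Z_0=1$, $Z_{n+1}=\sum_{i=1}^{Z_n}X_{n,i}$ for $n\ge0$, where, conditionally on $\xi$, the random variables $X_{n,i}$ ($n\ge0$, $i\ge1$) are independent and each $X_{n,i}$ has distribution $p(\xi_n)$. $\mathbb{P}_\xi$ and $\mathbb{E}_\xi$ denote the conditional probability and expectation given $\xi$ (quenched law); $\mathbb{P}$ and $\mathbb{E}$ denote the total probability and expectation (annealed law). Notation: $m_n=\sum_{i\ge1}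 i\,p_i(\xi_n)$, $\Pi_0=1$, $\Pi_n=\prod_{i=0}^{n-1}m_i=\mathbb{E}_\xi Z_n$. The sequence $W_n=Z_n/\Pi_n$ is a nonnegative martingale under $\mathbb{P}_\xi$ with respect to $\mathcal{F}_n=\sigma(\xi_0,\xi_1,\dots;\,X_{k,i}, 0\le k\le n-1, i\ge1)$, and hence converges a.s. to a limit $W$. *)

theory Defs
  imports "HOL-Probability.Probability"
begin

definition seq_space :: "'e measure \<Rightarrow> (nat \<Rightarrow> 'e) measure" where
  "seq_space E = PiM UNIV (\<lambda>_. E)"

definition shift :: "(nat \<Rightarrow> 'e) \<Rightarrow> (nat \<Rightarrow> 'e)" where
  "shift x = (\<lambda>n. x (Suc n))"

definition path :: "(nat \<Rightarrow> 'a \<Rightarrow> 'e) \<Rightarrow> 'a \<Rightarrow> (nat \<Rightarrow> 'e)" where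
  "path \<xi> \<omega> = (\<lambda>n. \<xi> n \<omega>)"

definition stationary_seq :: "'a measure \<Rightarrow> 'e measure \<Rightarrow> (nat \<Rightarrow> 'a \<Rightarrow> 'e) \<Rightarrow> bool" where
  "stationary_seq M E \<xi> \<longleftrightarrow>
     distr M (seq_space E) (\<lambda>\<omega>. shift (path \<xi> \<omega>)) = distr M (seq_space E) (path \<xi>)"

definition ergodic_seq :: "'a measure \<Rightarrow> 'e measure \<Rightarrow> (nat \<Rightarrow> 'a \<Rightarrow> 'e) \<Rightarrow> bool" where
  "ergodic_seq M E \<xi> \<longleftrightarrow>
     (\<forall>A\<in>sets (seq_space E). shift -` A \<inter> space (seq_space E) = A \<longrightarrow>
        measure (distr M (seq_space E) (path \<xi>)) A \<in> {0, 1})"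

text \<open>The sub-sigma-algebra generated by the whole environment sequence; conditioning on
  it gives the quenched probability and expectation.\<close>

definition env_algebra :: "'a measure \<Rightarrow> 'e measure \<Rightarrow> (nat \<Rightarrow> 'a \<Rightarrow> 'e) \<Rightarrow> 'a measure" where
  "env_algebra M E \<xi> = vimage_algebra (space M) (path \<xi>) (seq_space E)"

lemma subalgebra_env_algebra:
  assumes "\<And>n. \<xi> n \<in> measurable M E"
  shows "subalgebra M (env_algebra M E \<xi>)"
proof -
  have "path \<xi> \<in> measurable M (seq_space E)"
    unfolding path_def seq_space_def using assms by (intro measurable_PiM_single') (auto dest: measurable_space)
  then show ?thesis
    unfolding subalgebra_def env_algebra_def by (auto simp: sets_vimage_algebra2 measurable_def)
qed

definition cond_prob_given :: "'a measure \<Rightarrow> 'a measure \<Rightarrow> 'a set \<Rightarrow> 'a \<Rightarrow> real" where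
  "cond_prob_given M F A = real_cond_exp M F (indicator A)"

definition cond_indep_vars ::
    "'a measure \<Rightarrow> 'a measure \<Rightarrow> ('i \<Rightarrow> 'b measure) \<Rightarrow> ('i \<Rightarrow> 'a \<Rightarrow> 'b) \<Rightarrow> 'i set \<Rightarrow> bool" where
  "cond_indep_vars M F N X I \<longleftrightarrow>
     (\<forall>i\<in>I. X i \<in> measurable M (N i)) \<and>
     (\<forall>J A. J \<subseteq> I \<longrightarrow> finite J \<longrightarrow> J \<noteq> {} \<longrightarrow> (\<forall>j\<in>J. A j \<in> sets (N j)) \<longrightarrow>
        (AE \<omega> in M. cond_prob_given M F (\<Inter>j\<in>J. X j -` A j \<inter> space M) \<omega> =
           (\<Prod>j\<in>J. cond_prob_given M F (X j -` A j \<inter> space M) \<omega>)))"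

locale branching_process_random_env = prob_space M
  for M :: "'a measure" +
  fixes E :: "'e measure"
    and \<xi> :: "nat \<Rightarrow> 'a \<Rightarrow> 'e"
    and offspring :: "'e \<Rightarrow> nat pmf"
    and X :: "nat \<Rightarrow> nat \<Rightarrow> 'a \<Rightarrow> nat"
  assumes env_measurable: "\<And>n. \<xi> n \<in> measurable M E"
    and env_stationary: "stationary_seq M E \<xi>"
    and env_ergodic: "ergodic_seq M E \<xi>"
    and offspring_measurable: "\<And>k. (\<lambda>e. pmf (offspring e) k) \<in> borel_measurable E"
    and offspring_mean_finite: "\<And>e. e \<in> space E \<Longrightarrow> integrable (measure_pmf (offspring e)) real"
    and offspring_mean_pos: "\<And>e. e \<in> space E \<Longrightarrow> 0 < measure_pmf.expectation (offspring e) real"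
    and X_cond_indep: "cond_indep_vars M (env_algebra M E \<xi>) (\<lambda>_. count_space UNIV)
          (\<lambda>(n, i). X n i) (UNIV \<times> {1..})"
    and X_cond_distr: "\<And>n i k. 1 \<le> i \<Longrightarrow>
          AE \<omega> in M. cond_prob_given M (env_algebra M E \<xi>) {\<omega>' \<in> space M. X n i \<omega>' = k} \<omega>
            = pmf (offspring (\<xi> n \<omega>)) k"

primrec BP_Z :: "(nat \<Rightarrow> nat \<Rightarrow> 'a \<Rightarrow> nat) \<Rightarrow> nat \<Rightarrow> 'a \<Rightarrow> nat" where
  "BP_Z X 0 \<omega> = 1"
| "BP_Z X (Suc n) \<omega> = (\<Sum>i=1..BP_Z X n \<omega>. X n i \<omega>)"

definition BP_m :: "('e \<Rightarrow> nat pmf) \<Rightarrow> (nat \<Rightarrow> 'a \<Rightarrow> 'e) \<Rightarrow> nat \<Rightarrow> 'a \<Rightarrow> real" where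
  "BP_m offspring \<xi> n \<omega> = measure_pmf.expectation (offspring (\<xi> n \<omega>)) real"

definition BP_Pi :: "('e \<Rightarrow> nat pmf) \<Rightarrow> (nat \<Rightarrow> 'a \<Rightarrow> 'e) \<Rightarrow> nat \<Rightarrow> 'a \<Rightarrow> real" where
  "BP_Pi offspring \<xi> n \<omega> = (\<Prod>i<n. BP_m offspring \<xi> i \<omega>)"

definition BP_W :: "('e \<Rightarrow> nat pmf) \<Rightarrow> (nat \<Rightarrow> 'a \<Rightarrow> 'e) \<Rightarrow> (nat \<Rightarrow> nat \<Rightarrow> 'a \<Rightarrow> nat) \<Rightarrow> nat \<Rightarrow> 'a \<Rightarrow> real" where
  "BP_W offspring \<xi> X n \<omega> = real (BP_Z X n \<omega>) / BP_Pi offspring \<xi> n \<omega>"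

definition BP_W_lim :: "('e \<Rightarrow> nat pmf) \<Rightarrow> (nat \<Rightarrow> 'a \<Rightarrow> 'e) \<Rightarrow> (nat \<Rightarrow> nat \<Rightarrow> 'a \<Rightarrow> nat) \<Rightarrow> 'a \<Rightarrow> real" where
  "BP_W_lim offspring \<xi> X \<omega> = lim (\<lambda>n. BP_W offspring \<xi> X n \<omega>)"

text \<open>The quenched moment of order \<open>p\<close> of \<open>Z 1 / m 0\<close>. It is a nonnegative conditional
  expectation with values in \<open>[0, \<infinity>]\<close>; the real-valued \<open>real_cond_exp\<close> would turn infinite
  values into 0.\<close>

definition quenched_moment ::
    "'a measure \<Rightarrow> 'e measure \<Rightarrow> (nat \<Rightarrow> 'a \<Rightarrow> 'e) \<Rightarrow> ('e \<Rightarrow> nat pmf) \<Rightarrow> (nat \<Rightarrow> nat \<Rightarrow> 'a \<Rightarrow> nat)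
      \<Rightarrow> real \<Rightarrow> 'a \<Rightarrow> ennreal" where
  "quenched_moment M E \<xi> offspring X p =
     nn_cond_exp M (env_algebra M E \<xi>)
       (\<lambda>\<omega>. ennreal ((real (BP_Z X 1 \<omega>) / BP_m offspring \<xi> 0 \<omega>) powr p))"

definition ext_log :: "ennreal \<Rightarrow> ereal" where
  "ext_log y = (if y = 0 then -\<infinity> else if y = \<infinity> then \<infinity> else ereal (ln (enn2real y)))"

text \<open>\<open>e2ennreal\<close> is the positive part, so this says that the expectation of \<open>log Y\<close>, as an
  extended real, is less than infinity. For the quenched moment of order \<open>p > 1\<close> one has
  \<open>log Y \<ge> 0\<close> almost surely by Jensen's inequality, so nothing is cut off.\<close>

definition expect_log_finite :: "'a measure \<Rightarrow> ('a \<Rightarrow> ennreal) \<Rightarrow> bool" where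
  "expect_log_finite M Y \<longleftrightarrow> (\<integral>\<^sup>+ \<omega>. e2ennreal (ext_log (Y \<omega>)) \<partial>M) < \<infinity>"

end

theory Submission
  imports Defs
begin

text \<open>
  Given the environment and the first \<open>n\<close> generations, \<open>W (n + 1) - W n\<close> is \<open>1 / \<Pi> n\<close> times a sum of
  \<open>Z n\<close> independent centred variables, so the von Bahr--Esseen inequality bounds its quenched
  \<open>p\<close>-th absolute moment by a constant times \<open>\<Pi> n powr (1 - p) * \<sigma> n\<close>, where \<open>\<sigma> n\<close> is the
  \<open>p\<close>-th absolute moment of a normalized centred offspring number. By the ergodic theorem \<open>\<Pi> n\<close> is
  at least \<open>m powr (n * (1 - \<delta>))\<close> up to a constant, and by the Borel--Cantelli lemma \<open>\<sigma> n\<close> grows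
  subexponentially. Since \<open>(p - 1) / p = 1 / q\<close>, for every \<open>s < 1 / q\<close> the sum of
  \<open>m powr (s * p * n) * \<bar>W (n + 1) - W n\<bar> powr p\<close> is almost surely finite, and the increments are
  eventually dominated by the geometric sequence \<open>m powr (- s * n)\<close>.
\<close>

subsection \<open>Sums of independent centred variables\<close>

lemma nn_integral_nat_pmf:
  fixes f :: "nat \<Rightarrow> ennreal"
  shows "(\<integral>\<^sup>+k. f k \<partial>measure_pmf P) = (\<Sum>k. ennreal (pmf P k) * f k)"
  by (simp add: nn_integral_measure_pmf nn_integral_count_space_nat)

text \<open>For \<bar>t\<bar> at most 1, weighted AM-GM gives the Bernoulli bound
  \<open>(1 + t) powr (p - 1) \<le> 1 + (p - 1) * t\<close>; multiplying by \<open>1 + t\<close>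
  leaves an error of order t squared, which is at most \<open>\<bar>t\<bar> powr p\<close> because p
  < 2. For larger t the power is at most 4 times \<open>\<bar>t\<bar> powr p\<close>, and
  compensating a negative linear term costs 2 more, hence the 6.\<close>

lemma powr_add_le_tangent_plus_powr:
  fixes t p :: real
  assumes p: "1 < p" "p < 2"
  shows "\<bar>1 + t\<bar> powr p \<le> 1 + p * t + 6 * \<bar>t\<bar> powr p"
proof (cases "\<bar>t\<bar> \<le> 1")
  case True
  have sq: "t\<^sup>2 \<le> \<bar>t\<bar> powr p"
  proof (cases "t = 0")
    case False
    have "\<bar>t\<bar> powr 2 \<le> \<bar>t\<bar> powr p"
      using p True False by (intro powr_mono') auto
    then show ?thesis using False by simp
  qed simp
  have "\<bar>1 + t\<bar> powr p \<le> (1 + t) * (1 + (p - 1) * t)"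
  proof (cases "t = -1")
    case False
    with True have t: "1 + t > 0" by auto
    have "(1 + t) powr (p - 1) * 1 powr (2 - p) \<le> (p - 1) * (1 + t) + (2 - p) * 1"
      using p t by (intro Youngs_inequality_0) auto
    then have "(1 + t) powr (p - 1) \<le> 1 + (p - 1) * t"
      by (simp add: algebra_simps)
    then have "(1 + t) * (1 + t) powr (p - 1) \<le> (1 + t) * (1 + (p - 1) * t)"
      using t by (intro mult_left_mono) auto
    moreover have "(1 + t) * (1 + t) powr (p - 1) = (1 + t) powr p"
      using t by (simp add: powr_mult_base)
    ultimately show ?thesis using t by simp
  qed simp
  also have "\<dots> = 1 + p * t + (p - 1) * t\<^sup>2"
    by (simp add: algebra_simps power2_eq_square)
  also have "(p - 1) * t\<^sup>2 \<le> 1 * t\<^sup>2"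
    using p by (intro mult_right_mono) auto
  finally show ?thesis using sq by (smt (verit) powr_ge_zero)
next
  case False
  have "\<bar>1 + t\<bar> powr p \<le> (2 * \<bar>t\<bar>) powr p"
    using False p by (intro powr_mono2) auto
  also have "\<dots> = 2 powr p * \<bar>t\<bar> powr p"
    by (simp add: powr_mult)
  also have "2 powr p \<le> (2::real) powr 2"
    using p by (intro powr_mono) auto
  then have "2 powr p * \<bar>t\<bar> powr p \<le> 4 * \<bar>t\<bar> powr p"
    by (intro mult_right_mono) auto
  finally have 1: "\<bar>1 + t\<bar> powr p \<le> 4 * \<bar>t\<bar> powr p" .
  have "\<bar>t\<bar> powr 1 \<le> \<bar>t\<bar> powr p"
    using False p by (intro powr_mono) auto
  then have "p * \<bar>t\<bar> \<le> 2 * \<bar>t\<bar> powr p"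
    using p by (intro mult_mono) auto
  moreover have "- (p * t) \<le> p * \<bar>t\<bar>"
    using p by (metis abs_ge_minus_self abs_mult abs_of_pos less_trans zero_less_one)
  ultimately show ?thesis using 1 by linarith
qed

text \<open>The previous bound at \<open>t = b / a\<close>, rescaled; the coefficient of
  \<open>b\<close> is the derivative of \<open>\<bar>a\<bar> powr p\<close>. At \<open>a = 0\<close>
  division by zero makes that coefficient 0, which is again the derivative.\<close>

lemma abs_add_powr_le:
  fixes a b p :: real
  assumes p: "1 < p" "p < 2"
  shows "\<bar>a + b\<bar> powr p \<le> \<bar>a\<bar> powr p + (p * \<bar>a\<bar> powr p / a) * b + 6 * \<bar>b\<bar> powr p"
proof (cases "a = 0")
  case False
  have "\<bar>a + b\<bar> powr p = (\<bar>a\<bar> * \<bar>1 + b / a\<bar>) powr p"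
    using False by (simp add: abs_mult[symmetric] algebra_simps)
  also have "\<dots> = \<bar>a\<bar> powr p * \<bar>1 + b / a\<bar> powr p"
    by (simp add: powr_mult)
  also have "\<dots> \<le> \<bar>a\<bar> powr p * (1 + p * (b / a) + 6 * \<bar>b / a\<bar> powr p)"
    by (intro mult_left_mono powr_add_le_tangent_plus_powr p) auto
  also have "\<dots> = \<bar>a\<bar> powr p + (p * \<bar>a\<bar> powr p / a) * b + 6 * (\<bar>a\<bar> powr p * \<bar>b / a\<bar> powr p)"
    by (simp add: algebra_simps)
  also have "\<bar>a\<bar> powr p * \<bar>b / a\<bar> powr p = \<bar>b\<bar> powr p"
    using False by (simp add: powr_mult[symmetric])
  finally show ?thesis .
qed (use p in simp)

text \<open>The linear term of the pointwise bound integrates to 0 because \<open>Y\<close> is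
  centred. An infinite moment of \<open>Y\<close> makes the claim trivial; a finite one makes the
  bound integrable.\<close>

lemma nn_integral_abs_add_powr_le:
  fixes a p :: real and Y :: "'b \<Rightarrow> real"
  assumes p: "1 < p" "p < 2"
    and int: "integrable (measure_pmf P) Y" and zero: "measure_pmf.expectation P Y = 0"
  shows "(\<integral>\<^sup>+x. ennreal (\<bar>a + Y x\<bar> powr p) \<partial>measure_pmf P)
    \<le> ennreal (\<bar>a\<bar> powr p) + 6 * (\<integral>\<^sup>+x. ennreal (\<bar>Y x\<bar> powr p) \<partial>measure_pmf P)"
proof (cases "(\<integral>\<^sup>+x. ennreal (\<bar>Y x\<bar> powr p) \<partial>measure_pmf P) = \<infinity>")
  case False
  define g where "g x = \<bar>a\<bar> powr p + (p * \<bar>a\<bar> powr p / a) * Y x + 6 * \<bar>Y x\<bar> powr p" for x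
  have i: "integrable (measure_pmf P) (\<lambda>x. \<bar>Y x\<bar> powr p)"
    using False by (intro integrableI_nonneg) (auto simp: less_top)
  have gint: "integrable (measure_pmf P) g"
    unfolding g_def using i int by auto
  have le: "\<bar>a + Y x\<bar> powr p \<le> g x" for x
    unfolding g_def by (rule abs_add_powr_le[OF p])
  have "(\<integral>\<^sup>+x. ennreal (\<bar>a + Y x\<bar> powr p) \<partial>measure_pmf P) \<le> (\<integral>\<^sup>+x. ennreal (g x) \<partial>measure_pmf P)"
    by (intro nn_integral_mono ennreal_leI le)
  also have "\<dots> = ennreal (measure_pmf.expectation P g)"
    using gint order_trans[OF powr_ge_zero le] by (intro nn_integral_eq_integral) auto
  also have "measure_pmf.expectation P g
      = \<bar>a\<bar> powr p + 6 * measure_pmf.expectation P (\<lambda>x. \<bar>Y x\<bar> powr p)"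
    unfolding g_def using i int zero by simp
  also have "ennreal \<dots> = ennreal (\<bar>a\<bar> powr p) + 6 * (\<integral>\<^sup>+x. ennreal (\<bar>Y x\<bar> powr p) \<partial>measure_pmf P)"
    using i by (simp add: nn_integral_eq_integral ennreal_mult ennreal_plus)
  finally show ?thesis .
qed (simp add: ennreal_mult_top)

text \<open>Adding one summand per step matches the later induction that adds one individual of a
  generation at a time.\<close>

primrec iid_sum_pmf :: "nat pmf \<Rightarrow> nat \<Rightarrow> nat pmf" where
  "iid_sum_pmf P 0 = return_pmf 0"
| "iid_sum_pmf P (Suc l) = bind_pmf (iid_sum_pmf P l) (\<lambda>s. map_pmf (\<lambda>x. s + x) P)"

text \<open>The convolution formula. As a finite sum it yields measurability in the environment, and
  it mirrors the decomposition of events in \<open>of_bool_partial_gen_Suc\<close>.\<close>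

lemma pmf_iid_sum_Suc:
  "ennreal (pmf (iid_sum_pmf P (Suc l)) s)
    = (\<Sum>t\<le>s. ennreal (pmf (iid_sum_pmf P l) t) * ennreal (pmf P (s - t)))"
proof -
  have *: "pmf (map_pmf (\<lambda>x. t + x) P) s = (if t \<le> s then pmf P (s - t) else 0)" for t
  proof (cases "t \<le> s")
    case True
    have "pmf (map_pmf (\<lambda>x. t + x) P) (t + (s - t)) = pmf P (s - t)"
      by (intro pmf_map_inj') (auto simp: inj_def)
    with True show ?thesis by simp
  next
    case False
    then show ?thesis by (auto simp: pmf_eq_0_set_pmf)
  qed
  show ?thesis
    unfolding iid_sum_pmf.simps ennreal_pmf_bind *
    by (subst nn_integral_measure_pmf_support[of "{..s}"]) (auto intro!: sum.cong simp: mult.commute)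
qed

lemma nn_integral_iid_sum:
  "(\<integral>\<^sup>+s. of_nat s \<partial>measure_pmf (iid_sum_pmf P k)) = of_nat k * (\<integral>\<^sup>+x. of_nat x \<partial>measure_pmf P)"
  by (induction k) (simp_all add: nn_integral_add nn_integral_const algebra_simps)

text \<open>A von Bahr--Esseen inequality: with the centred partial sum in the role of
  \<open>a\<close>, each further summand adds at most 6 times its own moment.\<close>

lemma iid_sum_moment_le:
  fixes p \<mu> :: real
  assumes p: "1 < p" "p < 2" and int: "integrable (measure_pmf P) real"
    and \<mu>: "\<mu> = measure_pmf.expectation P real" "0 < \<mu>"
  shows "(\<integral>\<^sup>+s. ennreal (\<bar>real s / \<mu> - real k\<bar> powr p) \<partial>measure_pmf (iid_sum_pmf P k))
    \<le> of_nat k * (6 * (\<integral>\<^sup>+x. ennreal (\<bar>real x / \<mu> - 1\<bar> powr p) \<partial>measure_pmf P))"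
proof (induction k)
  case (Suc k)
  define \<sigma> where "\<sigma> = (\<integral>\<^sup>+x. ennreal (\<bar>real x / \<mu> - 1\<bar> powr p) \<partial>measure_pmf P)"
  have i: "integrable (measure_pmf P) (\<lambda>x. real x / \<mu> - 1)"
    using int by auto
  have z: "measure_pmf.expectation P (\<lambda>x. real x / \<mu> - 1) = 0"
    using int \<mu> by simp
  have "(\<integral>\<^sup>+s. ennreal (\<bar>real s / \<mu> - real (Suc k)\<bar> powr p) \<partial>measure_pmf (iid_sum_pmf P (Suc k)))
     = (\<integral>\<^sup>+s. \<integral>\<^sup>+x. ennreal (\<bar>(real s / \<mu> - real k) + (real x / \<mu> - 1)\<bar> powr p) \<partial>measure_pmf P
         \<partial>measure_pmf (iid_sum_pmf P k))"
    by (simp add: add_divide_distrib algebra_simps)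
  also have "\<dots> \<le> (\<integral>\<^sup>+s. ennreal (\<bar>real s / \<mu> - real k\<bar> powr p) + 6 * \<sigma> \<partial>measure_pmf (iid_sum_pmf P k))"
    unfolding \<sigma>_def by (intro nn_integral_mono nn_integral_abs_add_powr_le p i z)
  also have "\<dots> = (\<integral>\<^sup>+s. ennreal (\<bar>real s / \<mu> - real k\<bar> powr p) \<partial>measure_pmf (iid_sum_pmf P k)) + 6 * \<sigma>"
    by (simp add: nn_integral_add)
  also have "\<dots> \<le> of_nat k * (6 * \<sigma>) + 6 * \<sigma>"
    using Suc.IH by (intro add_mono) (auto simp: \<sigma>_def)
  finally show ?case by (simp add: \<sigma>_def algebra_simps)
qed (use p in simp)

subsection \<open>The conditional law given the environment\<close>

context branching_process_random_env
begin

abbreviation "\<F> \<equiv> env_algebra M E \<xi>"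

lemma path_measurable: "path \<xi> \<in> measurable M (seq_space E)"
  unfolding path_def seq_space_def
  using env_measurable by (intro measurable_PiM_single') (auto dest: measurable_space)

lemma env_in_space: "\<omega> \<in> space M \<Longrightarrow> \<xi> n \<omega> \<in> space E"
  using env_measurable by (rule measurable_space)

lemma env_subalgebra: "subalgebra M \<F>"
  using env_measurable by (rule subalgebra_env_algebra)

sublocale env: finite_measure_subalgebra M \<F>
  by unfold_locales (rule env_subalgebra)

lemma space_env [simp]: "space \<F> = space M"
  using env_subalgebra by (simp add: subalgebra_def)

lemma measurable_env_seq: "\<xi> n \<in> measurable \<F> E"
proof -
  have "path \<xi> \<in> measurable \<F> (seq_space E)"
    unfolding env_algebra_def
    using measurable_space[OF path_measurable] by (intro measurable_vimage_algebra1) auto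
  moreover have "(\<lambda>x. x n) \<in> measurable (seq_space E) E"
    unfolding seq_space_def by measurable
  ultimately have "(\<lambda>\<omega>. path \<xi> \<omega> n) \<in> measurable \<F> E"
    by (rule measurable_compose)
  then show ?thesis by (simp add: path_def)
qed

lemma measurable_env_compose [measurable (raw)]:
  "f \<in> borel_measurable E \<Longrightarrow> (\<lambda>\<omega>. f (\<xi> n \<omega>)) \<in> borel_measurable \<F>"
  by (rule measurable_compose[OF measurable_env_seq])

lemma measurable_from_env:
  "f \<in> measurable \<F> N \<Longrightarrow> f \<in> measurable M N"
  by (rule measurable_from_subalg[OF env_subalgebra])

declare offspring_measurable [measurable]

lemma measurable_offspring_integral:
  assumes [measurable]: "\<And>k. (\<lambda>e. f e k) \<in> borel_measurable E"
  shows "(\<lambda>e. \<integral>\<^sup>+k. f e k \<partial>measure_pmf (offspring e)) \<in> borel_measurable E"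
  unfolding nn_integral_nat_pmf by measurable

lemma measurable_offspring_mean [measurable]:
  "(\<lambda>e. measure_pmf.expectation (offspring e) real) \<in> borel_measurable E"
proof -
  have "measure_pmf.expectation (offspring e) real
      = enn2real (\<integral>\<^sup>+k. ennreal (real k) \<partial>measure_pmf (offspring e))" for e
    by (intro integral_eq_nn_integral) auto
  moreover have "(\<lambda>e. \<integral>\<^sup>+k. ennreal (real k) \<partial>measure_pmf (offspring e)) \<in> borel_measurable E"
    by (rule measurable_offspring_integral) simp
  ultimately show ?thesis by simp
qed

lemma measurable_BP_m [measurable]: "BP_m offspring \<xi> n \<in> borel_measurable \<F>"
  unfolding BP_m_def by measurable

lemma measurable_BP_Pi [measurable]: "BP_Pi offspring \<xi> n \<in> borel_measurable \<F>"
  unfolding BP_Pi_def by measurable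

lemma BP_m_pos: "\<omega> \<in> space M \<Longrightarrow> 0 < BP_m offspring \<xi> n \<omega>"
  unfolding BP_m_def by (intro offspring_mean_pos env_in_space)

lemma BP_Pi_pos: "\<omega> \<in> space M \<Longrightarrow> 0 < BP_Pi offspring \<xi> n \<omega>"
  unfolding BP_Pi_def by (intro prod_pos BP_m_pos)

lemma ennreal_BP_m:
  assumes "\<omega> \<in> space M"
  shows "ennreal (BP_m offspring \<xi> n \<omega>) = (\<integral>\<^sup>+x. of_nat x \<partial>measure_pmf (offspring (\<xi> n \<omega>)))"
proof -
  have "(\<integral>\<^sup>+x. ennreal (real x) \<partial>measure_pmf (offspring (\<xi> n \<omega>))) = ennreal (BP_m offspring \<xi> n \<omega>)"
    unfolding BP_m_def
    using offspring_mean_finite[OF env_in_space[OF assms]] by (intro nn_integral_eq_integral) auto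
  then show ?thesis by (simp add: ennreal_of_nat_eq_real_of_nat)
qed

lemma measurable_X: "1 \<le> i \<Longrightarrow> X n i \<in> measurable M (count_space UNIV)"
  using X_cond_indep unfolding cond_indep_vars_def by (auto simp: split_beta)

lemma measurable_BP_Z [measurable]: "BP_Z X n \<in> measurable M (count_space UNIV)"
proof (induction n)
  case (Suc n)
  note Suc [measurable]
  have "(\<lambda>\<omega>. (\<Sum>i=1..k. X n i \<omega>)) \<in> measurable M (count_space UNIV)" for k
    using measurable_X by (intro measurable_sum_nat) auto
  then have "(\<lambda>\<omega>. (\<lambda>k \<omega>. (\<Sum>i=1..k. X n i \<omega>)) (BP_Z X n \<omega>) \<omega>) \<in> measurable M (count_space UNIV)"
    by (rule measurable_compose_countable[OF _ Suc])
  then show ?case by simp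
next
  case 0
  then show ?case by (simp add: fun_eq_iff)
qed

text \<open>\<open>real_cond_exp\<close> is a difference of two \<open>enn2real\<close> values. For
  an indicator the subtracted one vanishes and the other is at most 1, so the conversion to reals
  loses nothing.\<close>

lemma nn_cond_exp_indicator:
  assumes [measurable]: "S \<in> sets M"
  shows "AE \<omega> in M. nn_cond_exp M \<F> (indicator S) \<omega> = ennreal (cond_prob_given M \<F> S \<omega>)"
proof -
  have "AE \<omega> in M. nn_cond_exp M \<F> (indicator S) \<omega> \<le> nn_cond_exp M \<F> (\<lambda>_. 1) \<omega>"
    by (intro env.nn_cond_exp_mono) (auto simp: indicator_def)
  moreover have "AE \<omega> in M. 1 = nn_cond_exp M \<F> (\<lambda>_. 1) \<omega>"
    by (intro env.nn_cond_exp_F_meas) auto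
  moreover have "AE \<omega> in M. 0 = nn_cond_exp M \<F> (\<lambda>_. 0) \<omega>"
    by (intro env.nn_cond_exp_F_meas) auto
  ultimately show ?thesis
  proof eventually_elim
    case (elim \<omega>)
    have "(\<lambda>x. ennreal (- indicator S x)) = (\<lambda>_. 0)" "(\<lambda>x. ennreal (indicator S x)) = indicator S"
      by (auto simp: fun_eq_iff indicator_def ennreal_neg)
    moreover have "nn_cond_exp M \<F> (indicator S) \<omega> < \<top>"
      using elim(1) unfolding elim(2)[symmetric] by (rule le_less_trans) simp
    ultimately show ?case
      by (simp add: cond_prob_given_def real_cond_exp_def elim(3)[symmetric])
  qed
qed

text \<open>The quenched product law of finitely many offspring counts, tested against a function
  \<open>h\<close> of the environment. In this integrated form later arguments only manipulate
  nonnegative integrals. The empty \<open>J\<close> is treated apart since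
  \<open>cond_indep_vars\<close> speaks of nonempty index sets.\<close>

lemma nn_integral_X_cylinder:
  assumes J: "finite J" "J \<subseteq> UNIV \<times> {1..}" and [measurable]: "h \<in> borel_measurable \<F>"
  shows "(\<integral>\<^sup>+\<omega>. h \<omega> * of_bool (\<forall>(n, i)\<in>J. X n i \<omega> = a (n, i)) \<partial>M)
    = (\<integral>\<^sup>+\<omega>. h \<omega> * (\<Prod>(n, i)\<in>J. ennreal (pmf (offspring (\<xi> n \<omega>)) (a (n, i)))) \<partial>M)"
proof (cases "J = {}")
  case False
  define S where "S = (\<Inter>j\<in>J. (\<lambda>(n, i). X n i) j -` {a j} \<inter> space M)"
  have meas: "(\<lambda>(n, i). X n i) j -` {a j} \<inter> space M \<in> sets M" if "j \<in> J" for j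
    using J that measurable_X by (intro measurable_sets[where A="count_space UNIV"]) auto
  have [measurable]: "S \<in> sets M"
    unfolding S_def using J False meas by (intro sets.finite_INT) auto
  have "AE \<omega> in M. cond_prob_given M \<F> S \<omega>
      = (\<Prod>j\<in>J. cond_prob_given M \<F> ((\<lambda>(n, i). X n i) j -` {a j} \<inter> space M) \<omega>)"
    using X_cond_indep J False unfolding S_def cond_indep_vars_def by simp
  moreover have "AE \<omega> in M. \<forall>j\<in>J. cond_prob_given M \<F> ((\<lambda>(n, i). X n i) j -` {a j} \<inter> space M) \<omega>
      = pmf (offspring (\<xi> (fst j) \<omega>)) (a j)"
  proof (intro AE_finite_allI J)
    fix j assume "j \<in> J"
    moreover have "(\<lambda>(n, i). X n i) j -` {a j} \<inter> space M = {\<omega> \<in> space M. X (fst j) (snd j) \<omega> = a j}"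
      by (auto simp: split_beta)
    ultimately show "AE \<omega> in M. cond_prob_given M \<F> ((\<lambda>(n, i). X n i) j -` {a j} \<inter> space M) \<omega>
        = pmf (offspring (\<xi> (fst j) \<omega>)) (a j)"
      using X_cond_distr[of "snd j" "fst j" "a j"] J by auto
  qed
  moreover note nn_cond_exp_indicator[OF \<open>S \<in> sets M\<close>]
  ultimately have *: "AE \<omega> in M. nn_cond_exp M \<F> (indicator S) \<omega>
      = (\<Prod>(n, i)\<in>J. ennreal (pmf (offspring (\<xi> n \<omega>)) (a (n, i))))"
    by eventually_elim (auto simp: split_beta prod_ennreal intro!: arg_cong[where f=ennreal] prod.cong)
  have "(\<integral>\<^sup>+\<omega>. h \<omega> * of_bool (\<forall>(n, i)\<in>J. X n i \<omega> = a (n, i)) \<partial>M)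
      = (\<integral>\<^sup>+\<omega>. h \<omega> * indicator S \<omega> \<partial>M)"
    using False by (intro nn_integral_cong) (force simp: S_def indicator_def)
  also have "\<dots> = (\<integral>\<^sup>+\<omega>. h \<omega> * nn_cond_exp M \<F> (indicator S) \<omega> \<partial>M)"
    by (rule env.nn_cond_exp_intg[symmetric]) auto
  also have "\<dots> = (\<integral>\<^sup>+\<omega>. h \<omega> * (\<Prod>(n, i)\<in>J. ennreal (pmf (offspring (\<xi> n \<omega>)) (a (n, i)))) \<partial>M)"
    using * by (intro nn_integral_cong_AE) auto
  finally show ?thesis .
qed simp

end

section \<open>Cylinder events and the quenched transition from one generation to the next\<close>

lemma suminf_of_bool_eq:
  fixes f :: "nat \<Rightarrow> ennreal"
  shows "(\<Sum>l. of_bool (x = l) * f l) = f x"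
  by (subst suminf_finite[of "{x}"]) auto

lemma measurable_of_bool_ennreal [measurable (raw)]:
  "Measurable.pred N Q \<Longrightarrow> (\<lambda>x. of_bool (Q x) :: ennreal) \<in> borel_measurable N"
  unfolding of_bool_def by measurable

context branching_process_random_env
begin

definition cyl :: "(nat \<times> nat) set \<Rightarrow> (nat \<times> nat \<Rightarrow> nat) \<Rightarrow> 'a \<Rightarrow> ennreal" where
  "cyl J a \<omega> = of_bool (\<forall>(n, i)\<in>J. X n i \<omega> = a (n, i))"

text \<open>The quenched probability of the event behind \<open>cyl J a\<close>, for finite
  \<open>J\<close> whose second indices are at least 1.\<close>

definition cyl_weight :: "(nat \<times> nat) set \<Rightarrow> (nat \<times> nat \<Rightarrow> nat) \<Rightarrow> 'a \<Rightarrow> ennreal" where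
  "cyl_weight J a \<omega> = (\<Prod>(n, i)\<in>J. ennreal (pmf (offspring (\<xi> n \<omega>)) (a (n, i))))"

text \<open>The indices of offspring counts that enter neither \<open>BP_Z X n\<close> nor the
  progeny of the first \<open>l\<close> individuals of generation \<open>n\<close>.\<close>

definition fresh :: "nat \<Rightarrow> nat \<Rightarrow> (nat \<times> nat) set" where
  "fresh n l = {(j, i). 1 \<le> i \<and> (n < j \<or> j = n \<and> l < i)}"

lemma cyl_empty [simp]: "cyl {} a \<omega> = 1" and cyl_weight_empty [simp]: "cyl_weight {} a \<omega> = 1"
  by (simp_all add: cyl_def cyl_weight_def)

lemma cyl_insert:
  "j \<notin> J \<Longrightarrow> cyl (insert j J) (a(j := v)) \<omega> = of_bool (X (fst j) (snd j) \<omega> = v) * cyl J a \<omega>"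
  by (auto simp: cyl_def split_beta)

lemma cyl_weight_insert:
  assumes "finite J" "j \<notin> J"
  shows "cyl_weight (insert j J) (a(j := v)) \<omega>
    = ennreal (pmf (offspring (\<xi> (fst j) \<omega>)) v) * cyl_weight J a \<omega>"
  using assms by (auto simp: cyl_weight_def split_beta intro!: arg_cong2[where f="(*)"] prod.cong)

lemma measurable_cyl:
  assumes "finite J" "J \<subseteq> fresh n l"
  shows "cyl J a \<in> borel_measurable M"
proof -
  have "(\<lambda>\<omega>. \<forall>j\<in>J. X (fst j) (snd j) \<omega> = a j) \<in> measurable M (count_space UNIV)"
  proof (intro pred_intros_finite assms)
    fix j assume "j \<in> J"
    then have "X (fst j) (snd j) \<in> measurable M (count_space UNIV)"
      using assms by (intro measurable_X) (auto simp: fresh_def)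
    then show "Measurable.pred M (\<lambda>\<omega>. X (fst j) (snd j) \<omega> = a j)"
      by measurable
  qed
  then have "(\<lambda>\<omega>. of_bool (\<forall>j\<in>J. X (fst j) (snd j) \<omega> = a j) :: ennreal) \<in> borel_measurable M"
    by (rule measurable_of_bool_ennreal)
  then show ?thesis
    by (simp add: cyl_def[abs_def] split_beta)
qed

lemma measurable_cyl_weight [measurable]: "cyl_weight J a \<in> borel_measurable \<F>"
  unfolding cyl_weight_def[abs_def] split_beta by measurable

lemma measurable_pmf_iid_sum:
  "(\<lambda>e. ennreal (pmf (iid_sum_pmf (offspring e) l) s)) \<in> borel_measurable E"
proof (induction l arbitrary: s)
  case (Suc l)
  note Suc [measurable]
  show ?case unfolding pmf_iid_sum_Suc by measurable
qed simp

lemma measurable_pmf_iid_sum_env [measurable]: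
  "(\<lambda>\<omega>. ennreal (pmf (iid_sum_pmf (offspring (\<xi> n \<omega>)) l) s)) \<in> borel_measurable \<F>"
  by (rule measurable_env_compose[OF measurable_pmf_iid_sum])

text \<open>The number \<open>l\<close> of parents is deterministic here; the random number of
  parents is restored by \<open>BP_Z_Suc\<close>.\<close>

definition partial_gen :: "nat \<Rightarrow> nat \<Rightarrow> 'a \<Rightarrow> nat" where
  "partial_gen n l \<omega> = (\<Sum>i=1..l. X n i \<omega>)"

lemma measurable_partial_gen [measurable]: "partial_gen n l \<in> measurable M (count_space UNIV)"
  unfolding partial_gen_def[abs_def] using measurable_X by (intro measurable_sum_nat) auto

lemma BP_Z_Suc: "BP_Z X (Suc n) \<omega> = partial_gen n (BP_Z X n \<omega>) \<omega>"
  by (simp add: partial_gen_def)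

text \<open>The event-level counterpart of \<open>pmf_iid_sum_Suc\<close>. Restricting to
  \<open>t \<le> s\<close> keeps the truncated subtraction \<open>s - t\<close> exact.\<close>

lemma of_bool_partial_gen_Suc:
  "(of_bool (partial_gen n (Suc l) \<omega> = s) :: ennreal)
    = (\<Sum>t\<le>s. of_bool (partial_gen n l \<omega> = t) * of_bool (X n (Suc l) \<omega> = s - t))"
proof (cases "partial_gen n l \<omega> \<le> s")
  case True
  then have "(\<Sum>t\<le>s. of_bool (partial_gen n l \<omega> = t) * of_bool (X n (Suc l) \<omega> = s - t))
      = (\<Sum>t\<in>{partial_gen n l \<omega>}. of_bool (X n (Suc l) \<omega> = s - t) :: ennreal)"
    by (intro sum.mono_neutral_cong_right) auto
  with True show ?thesis by (auto simp: partial_gen_def)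
next
  case False
  then have "(\<Sum>t\<le>s. of_bool (partial_gen n l \<omega> = t) * of_bool (X n (Suc l) \<omega> = s - t)) = (0 :: ennreal)"
    by (intro sum.neutral) auto
  with False show ?thesis by (auto simp: partial_gen_def)
qed

text \<open>Induction on \<open>l\<close>: the last summand is split off and recorded as one more
  coordinate of the cylinder, so the induction hypothesis must allow arbitrary \<open>J\<close> and
  \<open>a\<close>. The premise \<open>gen\<close> is the conditional independence of
  \<open>BP_Z X n\<close> from fresh cylinders, which is itself proved by induction on
  \<open>n\<close> with the help of this lemma.\<close>

lemma nn_integral_partial_gen_aux:
  assumes gen: "\<And>h k a J. h \<in> borel_measurable \<F> \<Longrightarrow> finite J \<Longrightarrow> J \<subseteq> fresh n 0 \<Longrightarrow>
      (\<integral>\<^sup>+\<omega>. h \<omega> * of_bool (BP_Z X n \<omega> = k) * cyl J a \<omega> \<partial>M)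
      = (\<integral>\<^sup>+\<omega>. h \<omega> * of_bool (BP_Z X n \<omega> = k) * cyl_weight J a \<omega> \<partial>M)"
    and h: "h \<in> borel_measurable \<F>" and J: "finite J" "J \<subseteq> fresh n l"
  shows "(\<integral>\<^sup>+\<omega>. h \<omega> * of_bool (BP_Z X n \<omega> = k) * (of_bool (partial_gen n l \<omega> = s) * cyl J a \<omega>) \<partial>M)
    = (\<integral>\<^sup>+\<omega>. h \<omega> * of_bool (BP_Z X n \<omega> = k)
        * (ennreal (pmf (iid_sum_pmf (offspring (\<xi> n \<omega>)) l) s) * cyl_weight J a \<omega>) \<partial>M)"
  using J
proof (induction l arbitrary: s a J)
  case 0
  show ?case
  proof (cases "s = 0")
    case True
    then show ?thesis using gen[OF h 0] by (simp add: partial_gen_def)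
  qed (simp add: partial_gen_def)
next
  case (Suc l)
  note [measurable] = measurable_from_env[OF h] measurable_cyl[OF Suc.prems]
    measurable_from_env[OF measurable_cyl_weight] measurable_from_env[OF measurable_pmf_iid_sum_env]
  let ?j = "(n, Suc l)"
  let ?Z = "\<lambda>\<omega>. h \<omega> * of_bool (BP_Z X n \<omega> = k)"
  let ?P = "\<lambda>l s \<omega>. ennreal (pmf (iid_sum_pmf (offspring (\<xi> n \<omega>)) l) s)"
  \<comment> \<open>The split-off index is new to \<open>J\<close>, and it is fresh at level
    \<open>l\<close> although not at level \<open>Suc l\<close>.\<close>
  have j: "?j \<notin> J" and sub: "insert ?j J \<subseteq> fresh n l"
    using Suc.prems by (auto simp: fresh_def)
  have fin: "finite (insert ?j J)" using Suc.prems by simp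
  have c: "cyl (insert ?j J) (a(?j := v)) \<in> borel_measurable M" for v
    by (rule measurable_cyl[OF fin sub])
  note c [measurable]
  have "(\<integral>\<^sup>+\<omega>. ?Z \<omega> * (of_bool (partial_gen n (Suc l) \<omega> = s) * cyl J a \<omega>) \<partial>M)
    = (\<integral>\<^sup>+\<omega>. (\<Sum>t\<le>s. ?Z \<omega> * (of_bool (partial_gen n l \<omega> = t) * cyl (insert ?j J) (a(?j := s - t)) \<omega>)) \<partial>M)"
    unfolding of_bool_partial_gen_Suc cyl_insert[OF j]
    by (simp only: sum_distrib_left sum_distrib_right mult.assoc fst_conv snd_conv)
  also have "\<dots> = (\<Sum>t\<le>s. \<integral>\<^sup>+\<omega>. ?Z \<omega> * (of_bool (partial_gen n l \<omega> = t) * cyl (insert ?j J) (a(?j := s - t)) \<omega>) \<partial>M)"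
    by (intro nn_integral_sum) measurable
  also have "\<dots> = (\<Sum>t\<le>s. \<integral>\<^sup>+\<omega>. ?Z \<omega> * (?P l t \<omega> * cyl_weight (insert ?j J) (a(?j := s - t)) \<omega>) \<partial>M)"
    by (intro sum.cong refl Suc.IH fin sub)
  also have "\<dots> = (\<integral>\<^sup>+\<omega>. (\<Sum>t\<le>s. ?Z \<omega> * (?P l t \<omega> * cyl_weight (insert ?j J) (a(?j := s - t)) \<omega>)) \<partial>M)"
    by (intro nn_integral_sum[symmetric]) measurable
  also have "\<dots> = (\<integral>\<^sup>+\<omega>. ?Z \<omega> * (?P (Suc l) s \<omega> * cyl_weight J a \<omega>) \<partial>M)"
    unfolding pmf_iid_sum_Suc cyl_weight_insert[OF Suc.prems(1) j]
    by (simp add: sum_distrib_left sum_distrib_right mult.assoc)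
  finally show ?case .
qed

lemma nn_integral_BP_Z_cyl:
  assumes "h \<in> borel_measurable \<F>" "finite J" "J \<subseteq> fresh n 0"
  shows "(\<integral>\<^sup>+\<omega>. h \<omega> * of_bool (BP_Z X n \<omega> = k) * cyl J a \<omega> \<partial>M)
    = (\<integral>\<^sup>+\<omega>. h \<omega> * of_bool (BP_Z X n \<omega> = k) * cyl_weight J a \<omega> \<partial>M)"
  using assms
proof (induction n arbitrary: h k a J)
  case 0
  have "J \<subseteq> UNIV \<times> {1..}"
    using 0 by (auto simp: fresh_def)
  \<comment> \<open>\<open>BP_Z X 0\<close> is the constant 1, so its indicator is absorbed into the
    test function.\<close>
  moreover have "(\<lambda>\<omega>. h \<omega> * of_bool (Suc 0 = k)) \<in> borel_measurable \<F>"
    using 0 by measurable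
  ultimately show ?case
    using nn_integral_X_cylinder[of J "\<lambda>\<omega>. h \<omega> * of_bool (Suc 0 = k)" a] 0
    by (simp add: cyl_def cyl_weight_def)
next
  case (Suc n)
  note aux = nn_integral_partial_gen_aux[OF Suc.IH]
  \<comment> \<open>All indices in \<open>J\<close> belong to generations after \<open>n\<close>, so
    they stay fresh whatever the size of generation \<open>n\<close>.\<close>
  have sub: "J \<subseteq> fresh n l" for l
    using Suc.prems by (auto simp: fresh_def)
  note [measurable] = measurable_from_env[OF Suc.prems(1)] measurable_cyl[OF Suc.prems(2,3)]
    measurable_from_env[OF measurable_cyl_weight] measurable_from_env[OF measurable_pmf_iid_sum_env]
  let ?P = "\<lambda>l \<omega>. ennreal (pmf (iid_sum_pmf (offspring (\<xi> n \<omega>)) l) k)"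
  have split: "(\<Sum>l. x * of_bool (BP_Z X n \<omega> = l) * (of_bool (partial_gen n l \<omega> = k) * y))
      = x * of_bool (BP_Z X (Suc n) \<omega> = k) * y" for \<omega> and x y :: ennreal
  proof -
    have "(\<Sum>l. x * of_bool (BP_Z X n \<omega> = l) * (of_bool (partial_gen n l \<omega> = k) * y))
        = (\<Sum>l. of_bool (BP_Z X n \<omega> = l) * (x * (of_bool (partial_gen n l \<omega> = k) * y)))"
      by (simp only: ac_simps)
    also have "\<dots> = x * (of_bool (partial_gen n (BP_Z X n \<omega>) \<omega> = k) * y)"
      by (rule suminf_of_bool_eq)
    finally show ?thesis by (simp only: BP_Z_Suc mult.assoc)
  qed
  have "(\<integral>\<^sup>+\<omega>. h \<omega> * of_bool (BP_Z X (Suc n) \<omega> = k) * cyl J a \<omega> \<partial>M)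
    = (\<integral>\<^sup>+\<omega>. (\<Sum>l. h \<omega> * of_bool (BP_Z X n \<omega> = l) * (of_bool (partial_gen n l \<omega> = k) * cyl J a \<omega>)) \<partial>M)"
    unfolding split ..
  also have "\<dots> = (\<Sum>l. \<integral>\<^sup>+\<omega>. h \<omega> * of_bool (BP_Z X n \<omega> = l) * (of_bool (partial_gen n l \<omega> = k) * cyl J a \<omega>) \<partial>M)"
    by (intro nn_integral_suminf) measurable
  also have "\<dots> = (\<Sum>l. \<integral>\<^sup>+\<omega>. h \<omega> * of_bool (BP_Z X n \<omega> = l) * (?P l \<omega> * cyl_weight J a \<omega>) \<partial>M)"
    by (intro suminf_cong aux Suc.prems sub)
  \<comment> \<open>The weight of \<open>J\<close> depends on the environment alone and moves into
    the test function; the auxiliary lemma is then read backwards with the empty cylinder to recover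
    the event.\<close>
  also have "\<dots> = (\<Sum>l. \<integral>\<^sup>+\<omega>. (h \<omega> * cyl_weight J a \<omega>) * of_bool (BP_Z X n \<omega> = l) * (?P l \<omega> * cyl_weight {} a \<omega>) \<partial>M)"
    by (simp add: ac_simps)
  also have "\<dots> = (\<Sum>l. \<integral>\<^sup>+\<omega>. (h \<omega> * cyl_weight J a \<omega>) * of_bool (BP_Z X n \<omega> = l) * (of_bool (partial_gen n l \<omega> = k) * cyl {} a \<omega>) \<partial>M)"
    using Suc.prems by (intro suminf_cong aux[symmetric]) auto
  also have "\<dots> = (\<integral>\<^sup>+\<omega>. (\<Sum>l. (h \<omega> * cyl_weight J a \<omega>) * of_bool (BP_Z X n \<omega> = l) * (of_bool (partial_gen n l \<omega> = k) * cyl {} a \<omega>)) \<partial>M)"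
    by (simp, intro nn_integral_suminf[symmetric]) measurable
  also have "\<dots> = (\<integral>\<^sup>+\<omega>. h \<omega> * of_bool (BP_Z X (Suc n) \<omega> = k) * cyl_weight J a \<omega> \<partial>M)"
    unfolding split by (simp only: cyl_empty mult_1_right mult_1_left ac_simps)
  finally show ?case .
qed

text \<open>The quenched Markov property: given the environment and \<open>BP_Z X n\<close>, the
  next generation is a sum of that many independent offspring counts. The proof sums over the values
  of both generations.\<close>

lemma nn_integral_BP_Z_step:
  fixes \<phi> :: "nat \<Rightarrow> nat \<Rightarrow> 'a \<Rightarrow> ennreal"
  assumes \<phi>: "\<And>k s. \<phi> k s \<in> borel_measurable \<F>"
  shows "(\<integral>\<^sup>+\<omega>. \<phi> (BP_Z X n \<omega>) (BP_Z X (Suc n) \<omega>) \<omega> \<partial>M)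
    = (\<integral>\<^sup>+\<omega>. (\<integral>\<^sup>+s. \<phi> (BP_Z X n \<omega>) s \<omega> \<partial>measure_pmf (iid_sum_pmf (offspring (\<xi> n \<omega>)) (BP_Z X n \<omega>))) \<partial>M)"
proof -
  note [measurable] = measurable_from_env[OF \<phi>] measurable_from_env[OF measurable_pmf_iid_sum_env]
  let ?P = "\<lambda>l s \<omega>. ennreal (pmf (iid_sum_pmf (offspring (\<xi> n \<omega>)) l) s)"
  have aux: "(\<integral>\<^sup>+\<omega>. \<phi> k s \<omega> * of_bool (BP_Z X n \<omega> = k) * of_bool (partial_gen n k \<omega> = s) \<partial>M)
      = (\<integral>\<^sup>+\<omega>. \<phi> k s \<omega> * of_bool (BP_Z X n \<omega> = k) * ?P k s \<omega> \<partial>M)" for k s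
    using nn_integral_partial_gen_aux[OF nn_integral_BP_Z_cyl \<phi>, of n "{}" k k s] by simp
  have "(\<integral>\<^sup>+\<omega>. \<phi> (BP_Z X n \<omega>) (BP_Z X (Suc n) \<omega>) \<omega> \<partial>M)
      = (\<integral>\<^sup>+\<omega>. (\<Sum>k. of_bool (BP_Z X n \<omega> = k) * (\<Sum>s. of_bool (partial_gen n k \<omega> = s) * \<phi> k s \<omega>)) \<partial>M)"
    unfolding suminf_of_bool_eq BP_Z_Suc ..
  also have "\<dots> = (\<integral>\<^sup>+\<omega>. (\<Sum>k. \<Sum>s. \<phi> k s \<omega> * of_bool (BP_Z X n \<omega> = k) * of_bool (partial_gen n k \<omega> = s)) \<partial>M)"
    by (simp add: ennreal_suminf_cmult[symmetric] ac_simps)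
  also have "\<dots> = (\<Sum>k. \<Sum>s. \<integral>\<^sup>+\<omega>. \<phi> k s \<omega> * of_bool (BP_Z X n \<omega> = k) * of_bool (partial_gen n k \<omega> = s) \<partial>M)"
    by (simp add: nn_integral_suminf)
  also have "\<dots> = (\<Sum>k. \<Sum>s. \<integral>\<^sup>+\<omega>. \<phi> k s \<omega> * of_bool (BP_Z X n \<omega> = k) * ?P k s \<omega> \<partial>M)"
    unfolding aux ..
  also have "\<dots> = (\<integral>\<^sup>+\<omega>. (\<Sum>k. \<Sum>s. \<phi> k s \<omega> * of_bool (BP_Z X n \<omega> = k) * ?P k s \<omega>) \<partial>M)"
    by (simp add: nn_integral_suminf)
  also have "\<dots> = (\<integral>\<^sup>+\<omega>. (\<Sum>k. of_bool (BP_Z X n \<omega> = k) * (\<Sum>s. ?P k s \<omega> * \<phi> k s \<omega>)) \<partial>M)"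
    by (simp add: ennreal_suminf_cmult[symmetric] ac_simps)
  also have "\<dots> = (\<integral>\<^sup>+\<omega>. (\<integral>\<^sup>+s. \<phi> (BP_Z X n \<omega>) s \<omega> \<partial>measure_pmf (iid_sum_pmf (offspring (\<xi> n \<omega>)) (BP_Z X n \<omega>))) \<partial>M)"
    unfolding suminf_of_bool_eq nn_integral_nat_pmf ..
  finally show ?thesis .
qed

text \<open>The quenched mean in integrated form. Each step produces a factor \<open>BP_m\<close>,
  which joins the test function before the induction hypothesis is applied.\<close>

lemma nn_integral_BP_Z:
  assumes "h \<in> borel_measurable \<F>"
  shows "(\<integral>\<^sup>+\<omega>. h \<omega> * of_nat (BP_Z X n \<omega>) \<partial>M) = (\<integral>\<^sup>+\<omega>. h \<omega> * ennreal (BP_Pi offspring \<xi> n \<omega>) \<partial>M)"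
  using assms
proof (induction n arbitrary: h)
  case 0
  then show ?case by (simp add: BP_Pi_def)
next
  case (Suc n)
  note Suc.prems [measurable]
  have "(\<integral>\<^sup>+\<omega>. h \<omega> * of_nat (BP_Z X (Suc n) \<omega>) \<partial>M)
      = (\<integral>\<^sup>+\<omega>. (\<integral>\<^sup>+s. h \<omega> * of_nat s \<partial>measure_pmf (iid_sum_pmf (offspring (\<xi> n \<omega>)) (BP_Z X n \<omega>))) \<partial>M)"
    by (rule nn_integral_BP_Z_step) measurable
  also have "\<dots> = (\<integral>\<^sup>+\<omega>. (h \<omega> * ennreal (BP_m offspring \<xi> n \<omega>)) * of_nat (BP_Z X n \<omega>) \<partial>M)"
    by (intro nn_integral_cong, subst nn_integral_cmult) (simp_all add: nn_integral_iid_sum ennreal_BP_m ac_simps)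
  also have "\<dots> = (\<integral>\<^sup>+\<omega>. (h \<omega> * ennreal (BP_m offspring \<xi> n \<omega>)) * ennreal (BP_Pi offspring \<xi> n \<omega>) \<partial>M)"
    by (rule Suc.IH) measurable
  also have "\<dots> = (\<integral>\<^sup>+\<omega>. h \<omega> * ennreal (BP_Pi offspring \<xi> (Suc n) \<omega>) \<partial>M)"
    using BP_m_pos BP_Pi_pos
    by (intro nn_integral_cong) (simp add: BP_Pi_def ennreal_mult'' less_imp_le ac_simps)
  finally show ?case .
qed

section \<open>Quenched moment bound for the martingale increments\<close>

definition central_moment :: "real \<Rightarrow> 'e \<Rightarrow> ennreal" where
  "central_moment p e = (\<integral>\<^sup>+x. ennreal (\<bar>real x / measure_pmf.expectation (offspring e) real - 1\<bar> powr p)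
     \<partial>measure_pmf (offspring e))"

lemma measurable_central_moment [measurable]: "central_moment p \<in> borel_measurable E"
  unfolding central_moment_def[abs_def] by (rule measurable_offspring_integral) measurable

text \<open>The increment is \<open>Z (n + 1) / m n - Z n\<close> divided by \<open>\<Pi> n\<close>.
  The division contributes the exponent \<open>- p\<close>, and the quenched mean of
  \<open>Z n\<close>, which counts the summands, contributes 1. The quantity
  \<open>\<sigma> n\<close> of the overview is
  \<open>central_moment p (\<xi> n \<omega>)\<close>.\<close>

lemma nn_integral_BP_W_increment_le:
  assumes p: "1 < p" "p < 2" and h [measurable]: "h \<in> borel_measurable \<F>"
  shows "(\<integral>\<^sup>+\<omega>. h \<omega> * ennreal (\<bar>BP_W offspring \<xi> X (Suc n) \<omega> - BP_W offspring \<xi> X n \<omega>\<bar> powr p) \<partial>M)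
    \<le> (\<integral>\<^sup>+\<omega>. h \<omega> * (6 * (ennreal (BP_Pi offspring \<xi> n \<omega> powr (1 - p)) * central_moment p (\<xi> n \<omega>))) \<partial>M)"
proof -
  let ?\<Pi> = "BP_Pi offspring \<xi> n" and ?m = "BP_m offspring \<xi> n"
  \<comment> \<open>The power of \<open>\<Pi> n\<close> is a function of the environment, so it can
    be part of the test function.\<close>
  define g where "g \<omega> = h \<omega> * ennreal (?\<Pi> \<omega> powr (- p))" for \<omega>
  define c where "c \<omega> = central_moment p (\<xi> n \<omega>)" for \<omega>
  have [measurable]: "g \<in> borel_measurable \<F>" "c \<in> borel_measurable \<F>"
    unfolding g_def c_def by measurable
  have "h \<omega> * ennreal (\<bar>BP_W offspring \<xi> X (Suc n) \<omega> - BP_W offspring \<xi> X n \<omega>\<bar> powr p)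
      = g \<omega> * ennreal (\<bar>real (BP_Z X (Suc n) \<omega>) / ?m \<omega> - real (BP_Z X n \<omega>)\<bar> powr p)"
    if \<omega>: "\<omega> \<in> space M" for \<omega>
  proof -
    have pos: "0 < ?m \<omega>" "0 < ?\<Pi> \<omega>" using \<omega> BP_m_pos BP_Pi_pos by auto
    have "BP_Pi offspring \<xi> (Suc n) \<omega> = ?\<Pi> \<omega> * ?m \<omega>" by (simp add: BP_Pi_def)
    then have "BP_W offspring \<xi> X (Suc n) \<omega> - BP_W offspring \<xi> X n \<omega>
        = (real (BP_Z X (Suc n) \<omega>) / ?m \<omega> - real (BP_Z X n \<omega>)) / ?\<Pi> \<omega>"
      using pos by (simp only: BP_W_def) (simp add: field_simps)
    then have "\<bar>BP_W offspring \<xi> X (Suc n) \<omega> - BP_W offspring \<xi> X n \<omega>\<bar> powr p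
        = ?\<Pi> \<omega> powr (- p) * \<bar>real (BP_Z X (Suc n) \<omega>) / ?m \<omega> - real (BP_Z X n \<omega>)\<bar> powr p"
      using pos by (simp only: abs_divide powr_divide powr_minus) (simp add: field_simps)
    then show ?thesis by (simp only: g_def ennreal_mult'' powr_ge_zero mult.assoc)
  qed
  then have "(\<integral>\<^sup>+\<omega>. h \<omega> * ennreal (\<bar>BP_W offspring \<xi> X (Suc n) \<omega> - BP_W offspring \<xi> X n \<omega>\<bar> powr p) \<partial>M)
      = (\<integral>\<^sup>+\<omega>. g \<omega> * ennreal (\<bar>real (BP_Z X (Suc n) \<omega>) / ?m \<omega> - real (BP_Z X n \<omega>)\<bar> powr p) \<partial>M)"
    by (rule nn_integral_cong)
  also have "\<dots> = (\<integral>\<^sup>+\<omega>. (\<integral>\<^sup>+s. g \<omega> * ennreal (\<bar>real s / ?m \<omega> - real (BP_Z X n \<omega>)\<bar> powr p)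
      \<partial>measure_pmf (iid_sum_pmf (offspring (\<xi> n \<omega>)) (BP_Z X n \<omega>))) \<partial>M)"
    by (rule nn_integral_BP_Z_step) measurable
  also have "\<dots> = (\<integral>\<^sup>+\<omega>. g \<omega> * (\<integral>\<^sup>+s. ennreal (\<bar>real s / ?m \<omega> - real (BP_Z X n \<omega>)\<bar> powr p)
      \<partial>measure_pmf (iid_sum_pmf (offspring (\<xi> n \<omega>)) (BP_Z X n \<omega>))) \<partial>M)"
    by (intro nn_integral_cong nn_integral_cmult) auto
  also have "\<dots> \<le> (\<integral>\<^sup>+\<omega>. g \<omega> * (of_nat (BP_Z X n \<omega>) * (6 * c \<omega>)) \<partial>M)"
  proof (intro nn_integral_mono mult_left_mono)
    fix \<omega> assume \<omega>: "\<omega> \<in> space M"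
    show "(\<integral>\<^sup>+s. ennreal (\<bar>real s / ?m \<omega> - real (BP_Z X n \<omega>)\<bar> powr p)
      \<partial>measure_pmf (iid_sum_pmf (offspring (\<xi> n \<omega>)) (BP_Z X n \<omega>))) \<le> of_nat (BP_Z X n \<omega>) * (6 * c \<omega>)"
      unfolding c_def central_moment_def BP_m_def
      using offspring_mean_finite offspring_mean_pos env_in_space[OF \<omega>]
      by (intro iid_sum_moment_le p) auto
  qed simp
  also have "\<dots> = (\<integral>\<^sup>+\<omega>. (g \<omega> * (6 * c \<omega>)) * of_nat (BP_Z X n \<omega>) \<partial>M)"
    by (simp add: ac_simps)
  also have "\<dots> = (\<integral>\<^sup>+\<omega>. (g \<omega> * (6 * c \<omega>)) * ennreal (?\<Pi> \<omega>) \<partial>M)"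
    by (rule nn_integral_BP_Z) measurable
  also have "\<dots> = (\<integral>\<^sup>+\<omega>. h \<omega> * (6 * (ennreal (?\<Pi> \<omega> powr (1 - p)) * c \<omega>)) \<partial>M)"
  proof (rule nn_integral_cong)
    fix \<omega> assume "\<omega> \<in> space M"
    then have pos: "0 < ?\<Pi> \<omega>" by (rule BP_Pi_pos)
    then have "?\<Pi> \<omega> powr (1 - p) = ?\<Pi> \<omega> powr (- p) * ?\<Pi> \<omega>"
      using powr_add[of "?\<Pi> \<omega>" "- p" 1] by simp
    then have "ennreal (?\<Pi> \<omega> powr (1 - p)) = ennreal (?\<Pi> \<omega> powr (- p)) * ennreal (?\<Pi> \<omega>)"
      using pos by (simp add: ennreal_mult)
    then show "(g \<omega> * (6 * c \<omega>)) * ennreal (?\<Pi> \<omega>) = h \<omega> * (6 * (ennreal (?\<Pi> \<omega> powr (1 - p)) * c \<omega>))"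
      by (simp add: g_def ac_simps)
  qed
  finally show ?thesis by (simp add: c_def)
qed

end

subsection \<open>Growth along the environment\<close>

text \<open>The least of the partial sums of lengths 0 to \<open>n\<close>. Recursion on the first
  term, rather than the last, brings in the shift that Garsia's argument compares with.\<close>

primrec min_sum :: "('e \<Rightarrow> real) \<Rightarrow> nat \<Rightarrow> (nat \<Rightarrow> 'e) \<Rightarrow> real" where
  "min_sum g 0 x = 0"
| "min_sum g (Suc n) x = min 0 (g (x 0) + min_sum g n (shift x))"

lemma min_sum_nonpos: "min_sum g n x \<le> 0"
  by (cases n) auto

lemma min_sum_Suc_le: "min_sum g (Suc n) x \<le> min_sum g n x"
proof (induction n arbitrary: x)
  case (Suc n)
  show ?case using Suc[of "shift x"] by (simp only: min_sum.simps(2)[of g "Suc n"] min_sum.simps(2)[of g n x])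
qed simp

lemma min_sum_antimono: "k \<le> n \<Longrightarrow> min_sum g n x \<le> min_sum g k x"
  by (rule lift_Suc_antimono_le[of "\<lambda>n. min_sum g n x"]) (rule min_sum_Suc_le)

lemma sum_shift: "(\<Sum>i<Suc n. g (x i)) = g (x 0) + (\<Sum>i<n. g (shift x i))"
  unfolding shift_def by (rule sum.lessThan_Suc_shift)

lemma min_sum_le_sum: "min_sum g n x \<le> (\<Sum>i<n. g (x i))"
  by (induction n arbitrary: x) (simp_all add: sum_shift min.coboundedI2 del: sum.lessThan_Suc)

lemma shift_measurable: "shift \<in> measurable (seq_space E) (seq_space E)"
  unfolding seq_space_def shift_def[abs_def]
  by (intro measurable_PiM_single') (auto simp: space_PiM PiE_iff)

text \<open>Counts the multiples of \<delta> below \<open>y\<close>, including 0, which accounts for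
  the \<open>+ 1\<close>. Taking expectations turns this into a summable series of tail
  probabilities.\<close>

lemma suminf_indicator_multiples_le:
  fixes y :: ennreal and \<delta> :: real
  assumes "0 < \<delta>"
  shows "(\<Sum>n. of_bool (ennreal (\<delta> * real n) < y) :: ennreal) \<le> ennreal (1 / \<delta>) * y + 1"
proof (cases y)
  case (real r)
  define K where "K = nat \<lceil>r / \<delta>\<rceil>"
  have "n < K" if "ennreal (\<delta> * real n) < y" for n
  proof -
    have "\<delta> * real n < r" using that assms real by (simp add: ennreal_less_iff)
    then have "real n < r / \<delta>" using assms by (simp add: field_simps)
    then show ?thesis unfolding K_def by linarith
  qed
  then have "(\<Sum>n. of_bool (ennreal (\<delta> * real n) < y) :: ennreal)
      = (\<Sum>n<K. of_bool (ennreal (\<delta> * real n) < y))"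
    by (intro suminf_finite) auto
  also have "\<dots> \<le> (\<Sum>n<K. 1)" by (intro sum_mono) auto
  also have "\<dots> = ennreal (real K)" by (simp add: ennreal_of_nat_eq_real_of_nat)
  also have "\<dots> \<le> ennreal (r / \<delta> + 1)"
  proof (rule ennreal_leI)
    have "0 \<le> r / \<delta>" using real assms by simp
    then have "real K = of_int \<lceil>r / \<delta>\<rceil>" unfolding K_def by simp
    then show "real K \<le> r / \<delta> + 1" using of_int_ceiling_le_add_one[of "r / \<delta>"] by simp
  qed
  also have "\<dots> = ennreal (1 / \<delta>) * y + 1"
    using real assms by (simp add: ennreal_mult[symmetric])
  finally show ?thesis .
qed (use assms in \<open>simp add: ennreal_mult_top\<close>)

context branching_process_random_env
begin

lemma shift_path_measurable: "(\<lambda>\<omega>. shift (path \<xi> \<omega>)) \<in> measurable M (seq_space E)"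
  by (rule measurable_compose[OF path_measurable shift_measurable])

lemma integrable_shift_iff:
  fixes f :: "(nat \<Rightarrow> 'e) \<Rightarrow> real"
  assumes "f \<in> borel_measurable (seq_space E)"
  shows "integrable M (\<lambda>\<omega>. f (shift (path \<xi> \<omega>))) \<longleftrightarrow> integrable M (\<lambda>\<omega>. f (path \<xi> \<omega>))"
  using env_stationary assms unfolding stationary_seq_def
  by (metis integrable_distr_eq path_measurable shift_path_measurable)

lemma integral_shift:
  fixes f :: "(nat \<Rightarrow> 'e) \<Rightarrow> real"
  assumes "f \<in> borel_measurable (seq_space E)"
  shows "(\<integral>\<omega>. f (shift (path \<xi> \<omega>)) \<partial>M) = (\<integral>\<omega>. f (path \<xi> \<omega>) \<partial>M)"
  using env_stationary assms unfolding stationary_seq_def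
  by (metis integral_distr path_measurable shift_path_measurable)

lemma nn_integral_env_stationary:
  fixes f :: "'e \<Rightarrow> ennreal"
  assumes [measurable]: "f \<in> borel_measurable E"
  shows "(\<integral>\<^sup>+\<omega>. f (\<xi> n \<omega>) \<partial>M) = (\<integral>\<^sup>+\<omega>. f (\<xi> 0 \<omega>) \<partial>M)"
proof (induction n)
  case (Suc n)
  have [measurable]: "(\<lambda>x. f (x n)) \<in> borel_measurable (seq_space E)"
    unfolding seq_space_def by measurable
  have "(\<integral>\<^sup>+\<omega>. f (\<xi> (Suc n) \<omega>) \<partial>M) = (\<integral>\<^sup>+\<omega>. (\<lambda>x. f (x n)) (shift (path \<xi> \<omega>)) \<partial>M)"
    by (simp add: shift_def path_def)
  also have "\<dots> = (\<integral>\<^sup>+x. f (x n) \<partial>distr M (seq_space E) (\<lambda>\<omega>. shift (path \<xi> \<omega>)))"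
    by (rule nn_integral_distr[symmetric, OF shift_path_measurable]) simp
  also have "\<dots> = (\<integral>\<^sup>+x. f (x n) \<partial>distr M (seq_space E) (path \<xi>))"
    using env_stationary by (simp add: stationary_seq_def)
  also have "\<dots> = (\<integral>\<^sup>+\<omega>. (\<lambda>x. f (x n)) (path \<xi> \<omega>) \<partial>M)"
    by (rule nn_integral_distr[OF path_measurable]) simp
  finally show ?case using Suc by (simp add: path_def)
qed simp

text \<open>Half of Birkhoff's theorem, by Garsia's argument: if the minimal partial sums tended to
  \<open>-\<infinity>\<close> almost surely, then \<open>min_sum (n + 1) - min_sum n \<circ> shift\<close>, whose integral is at most 0,
  would converge to \<open>g\<close> dominatedly.\<close>

lemma ergodic_sums_bounded_below:
  fixes g :: "'e \<Rightarrow> real"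
  assumes g [measurable]: "g \<in> borel_measurable E"
    and int: "integrable M (\<lambda>\<omega>. g (\<xi> 0 \<omega>))" and pos: "0 < (\<integral>\<omega>. g (\<xi> 0 \<omega>) \<partial>M)"
  shows "AE \<omega> in M. \<exists>c. \<forall>n. c \<le> (\<Sum>i<n. g (\<xi> i \<omega>))"
proof -
  let ?S = "seq_space E"
  \<comment> \<open>The paths whose partial sums are unbounded below; bounds ranging over
    \<open>nat\<close> keep the set measurable.\<close>
  define A where "A = {x \<in> space ?S. \<forall>c::nat. \<exists>n. (\<Sum>i<n. g (x i)) < - real c}"
  have comp [measurable]: "(\<lambda>x. g (x i)) \<in> borel_measurable ?S" for i
    unfolding seq_space_def by measurable
  have A [measurable]: "A \<in> sets ?S"
    unfolding A_def by measurable
  have shift_space: "shift x \<in> space ?S" if "x \<in> space ?S" for x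
    using measurable_space[OF shift_measurable that] .
  \<comment> \<open>Shifting changes the partial sums only by the fixed number
    \<open>g (x 0)\<close>, so \<open>A\<close> is exactly shift-invariant, as
    \<open>ergodic_seq\<close> demands.\<close>
  have sh1: "shift x \<in> A" if x: "x \<in> A" for x
  proof -
    have "\<exists>n. (\<Sum>i<n. g (shift x i)) < - real c" for c
    proof -
      obtain c' :: nat where c': "real c + \<bar>g (x 0)\<bar> \<le> real c'"
        using real_arch_simple by blast
      obtain n where n: "(\<Sum>i<n. g (x i)) < - real c'"
        using x unfolding A_def by blast
      then obtain k where k: "n = Suc k" by (cases n) auto
      have "g (x 0) + (\<Sum>i<k. g (shift x i)) < - real c'"
        using n unfolding k sum_shift .
      with c' have "(\<Sum>i<k. g (shift x i)) < - real c" by linarith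
      then show ?thesis by blast
    qed
    with x show ?thesis using shift_space by (simp add: A_def)
  qed
  have sh2: "x \<in> A" if x: "shift x \<in> A" "x \<in> space ?S" for x
  proof -
    have "\<exists>n. (\<Sum>i<n. g (x i)) < - real c" for c
    proof -
      obtain c' :: nat where c': "real c + \<bar>g (x 0)\<bar> \<le> real c'"
        using real_arch_simple by blast
      obtain n where n: "(\<Sum>i<n. g (shift x i)) < - real c'"
        using x unfolding A_def by blast
      then have "(\<Sum>i<Suc n. g (x i)) < - real c"
        unfolding sum_shift using c' by linarith
      then show ?thesis by blast
    qed
    with x show ?thesis by (simp add: A_def)
  qed
  have "A \<subseteq> space ?S"
    unfolding A_def by blast
  then have "shift -` A \<inter> space ?S = A"
    using sh1 sh2 by blast
  then have "measure (distr M ?S (path \<xi>)) A \<in> {0, 1}"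
    using env_ergodic A unfolding ergodic_seq_def by blast
  then have "prob (path \<xi> -` A \<inter> space M) \<in> {0, 1}"
    by (simp add: measure_distr[OF path_measurable A])
  moreover have "prob (path \<xi> -` A \<inter> space M) \<noteq> 1"
  proof
    assume "prob (path \<xi> -` A \<inter> space M) = 1"
    then have AE_A: "AE \<omega> in M. path \<xi> \<omega> \<in> A"
      using prob_eq_1[OF measurable_sets[OF path_measurable A]] by auto
    have ms [measurable]: "min_sum g n \<in> borel_measurable ?S" for n
    proof (induction n)
      case (Suc n)
      have [measurable]: "(\<lambda>x. min_sum g n (shift x)) \<in> borel_measurable ?S"
        by (rule measurable_compose[OF shift_measurable Suc])
      show ?case by (subst min_sum.simps(2)[abs_def]) measurable
    qed (simp add: fun_eq_iff[of "min_sum g 0" "\<lambda>_. 0", THEN iffD2])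
    have int_ms: "integrable M (\<lambda>\<omega>. min_sum g n (path \<xi> \<omega>))" for n
    proof (induction n)
      case (Suc n)
      then have "integrable M (\<lambda>\<omega>. min_sum g n (shift (path \<xi> \<omega>)))"
        by (simp add: integrable_shift_iff[OF ms])
      then show ?case
        using int by (auto simp: path_def intro!: integrable_min)
    qed simp
    have int_msh: "integrable M (\<lambda>\<omega>. min_sum g n (shift (path \<xi> \<omega>)))" for n
      using int_ms by (simp add: integrable_shift_iff[OF ms])
    define f where "f n \<omega> = min_sum g (Suc n) (path \<xi> \<omega>) - min_sum g n (shift (path \<xi> \<omega>))" for n \<omega>
    \<comment> \<open>This form shows both properties used below: the left entry is nonnegative, so
      \<open>f n\<close> is dominated by \<bar>g\<bar>, and once that entry exceeds \<open>g\<close>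
      the minimum equals \<open>g\<close>.\<close>
    have f_eq: "f n \<omega> = min (- min_sum g n (shift (path \<xi> \<omega>))) (g (\<xi> 0 \<omega>))" for n \<omega>
      by (simp add: f_def path_def)
    \<comment> \<open>Stationarity removes the shift, leaving the integral of a difference that is
      nonpositive because \<open>min_sum\<close> decreases in \<open>n\<close>.\<close>
    have int_f: "(\<integral>\<omega>. f n \<omega> \<partial>M) \<le> 0" for n
    proof -
      have "(\<integral>\<omega>. f n \<omega> \<partial>M) = (\<integral>\<omega>. min_sum g (Suc n) (path \<xi> \<omega>) \<partial>M) - (\<integral>\<omega>. min_sum g n (path \<xi> \<omega>) \<partial>M)"
        unfolding f_def using int_ms[of "Suc n"] int_msh[of n]
        by (subst Bochner_Integration.integral_diff) (auto simp: integral_shift[OF ms])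
      also have "\<dots> \<le> 0"
        using integral_mono[OF int_ms[of "Suc n"] int_ms[of n] min_sum_Suc_le] by simp
      finally show ?thesis .
    qed
    have "(\<lambda>n. \<integral>\<omega>. f n \<omega> \<partial>M) \<longlonglongrightarrow> (\<integral>\<omega>. g (\<xi> 0 \<omega>) \<partial>M)"
    proof (rule integral_dominated_convergence[where w="\<lambda>\<omega>. \<bar>g (\<xi> 0 \<omega>)\<bar>"])
      show "AE \<omega> in M. (\<lambda>n. f n \<omega>) \<longlonglongrightarrow> g (\<xi> 0 \<omega>)"
        using AE_A
      proof eventually_elim
        case (elim \<omega>)
        let ?x = "shift (path \<xi> \<omega>)"
        obtain c :: nat where c: "g (\<xi> 0 \<omega>) \<le> real c"
          using real_arch_simple by blast
        obtain k where k: "(\<Sum>i<k. g (?x i)) < - real c"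
          using sh1[OF elim] unfolding A_def by blast
        have "f n \<omega> = g (\<xi> 0 \<omega>)" if "k \<le> n" for n
        proof -
          have "min_sum g n ?x < - real c"
            using min_sum_antimono[OF that, of g ?x] min_sum_le_sum[of g k ?x] k by linarith
          with c show ?thesis by (simp add: f_eq)
        qed
        then show ?case
          by (intro tendsto_eventually) (auto simp: eventually_sequentially)
      qed
      show "AE \<omega> in M. norm (f n \<omega>) \<le> \<bar>g (\<xi> 0 \<omega>)\<bar>" for n
      proof (intro AE_I2)
        fix \<omega>
        show "norm (f n \<omega>) \<le> \<bar>g (\<xi> 0 \<omega>)\<bar>"
          using min_sum_nonpos[of g n "shift (path \<xi> \<omega>)"] by (auto simp: f_eq min_def)
      qed
      show "f n \<in> borel_measurable M" for n
        unfolding f_def[abs_def] using int_ms[of "Suc n"] int_msh[of n]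
        by (intro borel_measurable_diff) (auto dest: borel_measurable_integrable)
    qed (use int in auto)
    then have "(\<integral>\<omega>. g (\<xi> 0 \<omega>) \<partial>M) \<le> 0"
      using int_f by (intro LIMSEQ_le_const2) auto
    with pos show False by simp
  qed
  ultimately have "prob (path \<xi> -` A \<inter> space M) = 0" by simp
  then have "AE \<omega> in M. path \<xi> \<omega> \<notin> A"
    using prob_eq_0[OF measurable_sets[OF path_measurable A]] by auto
  with AE_space show ?thesis
  proof eventually_elim
    case (elim \<omega>)
    then have "path \<xi> \<omega> \<in> space ?S"
      using measurable_space[OF path_measurable] by blast
    with elim obtain c :: nat where "\<And>n. - real c \<le> (\<Sum>i<n. g (path \<xi> \<omega> i))"
      unfolding A_def by (auto simp: not_less)
    then show ?case unfolding path_def by blast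
  qed
qed

text \<open>By stationarity the exceedance probabilities are tails of the single variable
  \<open>f (\<xi> 0 \<omega>)\<close>; its finite mean makes them summable, and Borel--Cantelli
  applies.\<close>

lemma env_eventually_le_linear:
  fixes f :: "'e \<Rightarrow> ennreal" and \<delta> :: real
  assumes f [measurable]: "f \<in> borel_measurable E" and fin: "(\<integral>\<^sup>+\<omega>. f (\<xi> 0 \<omega>) \<partial>M) < \<infinity>"
    and \<delta>: "0 < \<delta>"
  shows "AE \<omega> in M. \<forall>\<^sub>F n in sequentially. f (\<xi> n \<omega>) \<le> ennreal (\<delta> * real n)"
proof -
  note [measurable] = env_measurable
  define A where "A n = {\<omega> \<in> space M. ennreal (\<delta> * real n) < f (\<xi> n \<omega>)}" for n
  have A [measurable]: "A n \<in> sets M" for n unfolding A_def by measurable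
  have "emeasure M (A n) = (\<integral>\<^sup>+\<omega>. of_bool (ennreal (\<delta> * real n) < f (\<xi> 0 \<omega>)) \<partial>M)" for n
  proof -
    have "emeasure M (A n) = (\<integral>\<^sup>+\<omega>. indicator (A n) \<omega> \<partial>M)" by simp
    also have "\<dots> = (\<integral>\<^sup>+\<omega>. (\<lambda>e. of_bool (ennreal (\<delta> * real n) < f e)) (\<xi> n \<omega>) \<partial>M)"
      by (intro nn_integral_cong) (auto simp: A_def indicator_def)
    also have "\<dots> = (\<integral>\<^sup>+\<omega>. (\<lambda>e. of_bool (ennreal (\<delta> * real n) < f e)) (\<xi> 0 \<omega>) \<partial>M)"
      by (rule nn_integral_env_stationary) measurable
    finally show ?thesis .
  qed
  then have "(\<Sum>n. ennreal (prob (A n))) = (\<Sum>n. \<integral>\<^sup>+\<omega>. of_bool (ennreal (\<delta> * real n) < f (\<xi> 0 \<omega>)) \<partial>M)"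
    by (simp add: emeasure_eq_measure)
  also have "\<dots> = (\<integral>\<^sup>+\<omega>. (\<Sum>n. of_bool (ennreal (\<delta> * real n) < f (\<xi> 0 \<omega>))) \<partial>M)"
    by (intro nn_integral_suminf[symmetric]) measurable
  also have "\<dots> \<le> (\<integral>\<^sup>+\<omega>. ennreal (1 / \<delta>) * f (\<xi> 0 \<omega>) + 1 \<partial>M)"
    by (intro nn_integral_mono suminf_indicator_multiples_le \<delta>)
  also have "\<dots> = ennreal (1 / \<delta>) * (\<integral>\<^sup>+\<omega>. f (\<xi> 0 \<omega>) \<partial>M) + 1"
    by (simp add: nn_integral_add nn_integral_cmult emeasure_space_1)
  also have "\<dots> < \<infinity>"
    using fin by (simp add: ennreal_mult_less_top)
  finally have "summable (\<lambda>n. prob (A n))"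
    by (intro summable_suminf_not_top) auto
  then have "AE \<omega> in M. \<forall>\<^sub>F n in sequentially. \<omega> \<in> space M - A n"
    by (intro borel_cantelli_AE1) (auto simp: emeasure_eq_measure)
  then show ?thesis
    by eventually_elim (auto simp: A_def not_less elim!: eventually_mono)
qed

end

subsection \<open>Convergence rate\<close>

lemma ennreal_inverse_mult_le_one: "inverse (x :: ennreal) * x \<le> 1"
proof (cases "x = 0 \<or> x = \<top>")
  case False
  then show ?thesis
    using ennreal_divide_self[of x] by (simp add: divide_ennreal_def mult.commute less_top)
qed auto

text \<open>Testing against \<open>1 / (1 + R)\<close>, where \<open>R\<close> is the sum of the bounds, replaces a conditional
  expectation given \<open>F\<close>.\<close>

lemma AE_suminf_finite_of_subalgebra_bound:
  fixes D B :: "nat \<Rightarrow> 'a \<Rightarrow> ennreal"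
  assumes sub: "subalgebra M F" and "finite_measure M"
    and D [measurable]: "\<And>n. D n \<in> borel_measurable M" and B: "\<And>n. B n \<in> borel_measurable F"
    and le: "\<And>n h. h \<in> borel_measurable F \<Longrightarrow> (\<integral>\<^sup>+\<omega>. h \<omega> * D n \<omega> \<partial>M) \<le> (\<integral>\<^sup>+\<omega>. h \<omega> * B n \<omega> \<partial>M)"
    and fin: "AE \<omega> in M. (\<Sum>n. B n \<omega>) < \<infinity>"
  shows "AE \<omega> in M. (\<Sum>n. D n \<omega>) < \<infinity>"
proof -
  interpret finite_measure M by fact
  define R where "R \<omega> = (\<Sum>n. B n \<omega>)" for \<omega>
  define h where "h \<omega> = inverse (1 + R \<omega>)" for \<omega>
  note B [measurable]
  have hF: "h \<in> borel_measurable F"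
    unfolding h_def[abs_def] R_def by measurable
  note [measurable] = measurable_from_subalg[OF sub hF] measurable_from_subalg[OF sub B]
  have hR: "h \<omega> * R \<omega> \<le> 1" for \<omega>
  proof -
    have "h \<omega> * R \<omega> \<le> h \<omega> * (1 + R \<omega>)" by (intro mult_left_mono) auto
    also have "\<dots> \<le> 1" unfolding h_def by (rule ennreal_inverse_mult_le_one)
    finally show ?thesis .
  qed
  have "(\<integral>\<^sup>+\<omega>. h \<omega> * (\<Sum>n. D n \<omega>) \<partial>M) = (\<Sum>n. \<integral>\<^sup>+\<omega>. h \<omega> * D n \<omega> \<partial>M)"
    unfolding ennreal_suminf_cmult[symmetric] by (rule nn_integral_suminf) measurable
  also have "\<dots> \<le> (\<Sum>n. \<integral>\<^sup>+\<omega>. h \<omega> * B n \<omega> \<partial>M)"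
    by (intro suminf_le le hF) auto
  also have "\<dots> = (\<integral>\<^sup>+\<omega>. h \<omega> * R \<omega> \<partial>M)"
    unfolding R_def ennreal_suminf_cmult[symmetric] by (rule nn_integral_suminf[symmetric]) measurable
  also have "\<dots> \<le> (\<integral>\<^sup>+\<omega>. 1 \<partial>M)"
    by (intro nn_integral_mono hR)
  also have "\<dots> < \<infinity>"
    using emeasure_finite[of "space M"] by (simp add: less_top[symmetric])
  finally have "AE \<omega> in M. h \<omega> * (\<Sum>n. D n \<omega>) \<noteq> \<infinity>"
    by (intro nn_integral_noteq_infinite) auto
  with fin show ?thesis
  proof eventually_elim
    case (elim \<omega>)
    \<comment> \<open>Finiteness of the sum of the bounds keeps the test function positive, so a
      finite product forces a finite series.\<close>
    have "h \<omega> \<noteq> 0"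
      using elim(1) by (simp add: h_def R_def less_top)
    with elim(2) show ?case
      by (auto simp: ennreal_mult_top less_top[symmetric] infinity_ennreal_def)
  qed
qed

text \<open>Telescoping: the tail increments are dominated by a geometric series. The same
  domination proves convergence, so that \<open>lim\<close> denotes the actual limit.\<close>

lemma abs_lim_diff_le_geometric:
  fixes W :: "nat \<Rightarrow> real"
  assumes r: "0 < r" "r < 1" and N: "\<And>n. N \<le> n \<Longrightarrow> \<bar>W (Suc n) - W n\<bar> \<le> r ^ n" and n: "N \<le> n"
  shows "\<bar>lim W - W n\<bar> \<le> r ^ n / (1 - r)"
proof -
  define f where "f j = W (Suc (j + n)) - W (j + n)" for j
  have le: "norm (f j) \<le> r ^ (j + n)" for j
    unfolding f_def using N[of "j + n"] n by simp
  have geo: "(\<lambda>j. r ^ (j + n)) sums (r ^ n / (1 - r))"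
    using sums_mult2[OF geometric_sums[of r], of "r ^ n"] r by (simp add: power_add field_simps)
  have sf: "summable f"
    using le geo by (intro summable_comparison_test'[where N=0, OF sums_summable]) auto
  have "(\<Sum>j<k. f j) = W (k + n) - W n" for k
    by (induction k) (auto simp: f_def)
  then have "(\<lambda>k. W (k + n) - W n) \<longlonglongrightarrow> suminf f"
    using summable_LIMSEQ[OF sf] by simp
  then have "(\<lambda>k. (W (k + n) - W n) + W n) \<longlonglongrightarrow> suminf f + W n"
    by (intro tendsto_intros)
  then have "W \<longlonglongrightarrow> suminf f + W n"
    by (simp add: LIMSEQ_offset)
  then have "lim W - W n = suminf f"
    using limI by fastforce
  also have "\<bar>suminf f\<bar> \<le> (\<Sum>j. r ^ (j + n))"
  proof -
    have sn: "summable (\<lambda>j. norm (f j))"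
      using le geo by (intro summable_comparison_test'[where N=0, OF sums_summable]) auto
    have "norm (suminf f) \<le> (\<Sum>j. norm (f j))" by (rule summable_norm[OF sn])
    also have "\<dots> \<le> (\<Sum>j. r ^ (j + n))" by (intro suminf_le le sn sums_summable[OF geo])
    finally show ?thesis by simp
  qed
  also have "\<dots> = r ^ n / (1 - r)"
    using geo by (simp add: sums_iff)
  finally show ?thesis .
qed

lemma abs_minus_one_powr_le:
  fixes x p :: real
  assumes "0 \<le> x" "0 < p"
  shows "\<bar>x - 1\<bar> powr p \<le> x powr p + 1"
proof (cases "1 \<le> x")
  case True
  then have "\<bar>x - 1\<bar> powr p \<le> x powr p" using assms by (intro powr_mono2) auto
  then show ?thesis by simp
next
  case False
  then have "\<bar>x - 1\<bar> powr p \<le> 1 powr p" using assms by (intro powr_mono2) auto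
  also have "\<dots> \<le> x powr p + 1" by simp
  finally show ?thesis .
qed

text \<open>\<open>e2ennreal\<close> sends negative logarithms to 0; this is harmless since
  \<open>r\<close> is nonnegative.\<close>

lemma le_exp_of_ext_log_le:
  assumes "e2ennreal (ext_log y) \<le> ennreal r" "0 \<le> r"
  shows "y \<le> ennreal (exp r)"
proof (cases y)
  case (real u)
  show ?thesis
  proof (cases "u = 0")
    case False
    with real have u: "0 < u" by simp
    then have "e2ennreal (ereal (ln u)) \<le> ennreal r"
      using assms(1) real by (simp add: ext_log_def)
    then have "ln u \<le> r"
      using assms(2) by (simp add: e2ennreal_ereal ennreal_le_iff)
    then have "u \<le> exp r"
      using u by (simp add: ln_le_cancel_iff[symmetric, of u "exp r"])
    then show ?thesis using real by (simp add: ennreal_leI)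
  qed (use real in simp)
next
  case top
  then show ?thesis using assms by (simp add: ext_log_def e2ennreal_infty top_unique)
qed

section \<open>Subexponential offspring moments, growth of the mean products, and
  summability\<close>

context branching_process_random_env
begin

definition normalized_moment :: "real \<Rightarrow> 'e \<Rightarrow> ennreal" where
  "normalized_moment p e = (\<integral>\<^sup>+x. ennreal ((real x / measure_pmf.expectation (offspring e) real) powr p)
     \<partial>measure_pmf (offspring e))"

lemma measurable_normalized_moment [measurable]: "normalized_moment p \<in> borel_measurable E"
  unfolding normalized_moment_def[abs_def] by (rule measurable_offspring_integral) measurable

lemma central_moment_le:
  assumes "0 < p"
  shows "central_moment p e \<le> normalized_moment p e + 1"
proof -
  let ?m = "measure_pmf.expectation (offspring e) real"
  have m: "0 \<le> ?m" by (intro integral_nonneg_AE) auto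
  have "central_moment p e \<le> (\<integral>\<^sup>+x. ennreal ((real x / ?m) powr p) + 1 \<partial>measure_pmf (offspring e))"
    unfolding central_moment_def
  proof (rule nn_integral_mono)
    fix x
    have "\<bar>real x / ?m - 1\<bar> powr p \<le> (real x / ?m) powr p + 1"
      using m assms by (intro abs_minus_one_powr_le) auto
    then have "ennreal (\<bar>real x / ?m - 1\<bar> powr p) \<le> ennreal ((real x / ?m) powr p + 1)"
      by (rule ennreal_leI)
    also have "\<dots> = ennreal ((real x / ?m) powr p) + 1"
      by (simp add: ennreal_plus)
    finally show "ennreal (\<bar>real x / ?m - 1\<bar> powr p) \<le> ennreal ((real x / ?m) powr p) + 1" .
  qed
  also have "\<dots> = normalized_moment p e + 1"
    by (simp add: nn_integral_add normalized_moment_def)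
  finally show ?thesis .
qed

text \<open>Identifies the moment as a function of \<open>\<xi> 0\<close> alone, so that
  stationarity can carry its log-integrability to every \<open>\<xi> n\<close>. Indicators of
  environment events are absorbed into the function tested in the one-step formula.\<close>

lemma quenched_moment_eq:
  "AE \<omega> in M. quenched_moment M E \<xi> offspring X p \<omega> = normalized_moment p (\<xi> 0 \<omega>)"
proof -
  let ?f = "\<lambda>\<omega>. ennreal ((real (BP_Z X 1 \<omega>) / BP_m offspring \<xi> 0 \<omega>) powr p)"
  note [measurable] = measurable_from_env[OF measurable_BP_m]
  have "AE \<omega> in M. normalized_moment p (\<xi> 0 \<omega>) = nn_cond_exp M \<F> ?f \<omega>"
  proof (rule env.nn_cond_exp_charact)
    fix A assume [measurable]: "A \<in> sets \<F>"
    have P: "iid_sum_pmf P (Suc 0) = P" for P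
      by (simp add: bind_return_pmf pmf.map_ident_strong)
    have "(\<integral>\<^sup>+\<omega>. ?f \<omega> * indicator A \<omega> \<partial>M)
        = (\<integral>\<^sup>+\<omega>. ennreal ((real (BP_Z X (Suc 0) \<omega>) / BP_m offspring \<xi> 0 \<omega>) powr p) * indicator A \<omega> \<partial>M)"
      by simp
    also have "\<dots> = (\<integral>\<^sup>+\<omega>. (\<integral>\<^sup>+s. ennreal ((real s / BP_m offspring \<xi> 0 \<omega>) powr p) * indicator A \<omega>
        \<partial>measure_pmf (iid_sum_pmf (offspring (\<xi> 0 \<omega>)) (BP_Z X 0 \<omega>))) \<partial>M)"
      by (rule nn_integral_BP_Z_step[where \<phi>="\<lambda>k s \<omega>. ennreal ((real s / BP_m offspring \<xi> 0 \<omega>) powr p) * indicator A \<omega>"])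
        measurable
    also have "\<dots> = (\<integral>\<^sup>+\<omega>. normalized_moment p (\<xi> 0 \<omega>) * indicator A \<omega> \<partial>M)"
      unfolding BP_Z.simps One_nat_def P normalized_moment_def BP_m_def
      by (intro nn_integral_cong nn_integral_multc) auto
    finally show "(\<integral>\<^sup>+\<omega>. ?f \<omega> * indicator A \<omega> \<partial>M) = (\<integral>\<^sup>+\<omega>. normalized_moment p (\<xi> 0 \<omega>) * indicator A \<omega> \<partial>M)" .
  qed measurable
  then show ?thesis
    unfolding quenched_moment_def by eventually_elim simp
qed

text \<open>The positive part of the log moment has finite mean, hence eventually grows at most like
  \<open>\<delta> * real n\<close>. Finiteness at every \<open>n\<close> is recorded as well,
  because an eventual bound says nothing about the early terms of a series.\<close>

lemma env_log_moment:
  assumes fin: "expect_log_finite M (quenched_moment M E \<xi> offspring X p)" and p: "0 < p" and \<delta>: "0 < \<delta>"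
  shows "AE \<omega> in M. (\<forall>n. central_moment p (\<xi> n \<omega>) < \<infinity>) \<and>
    (\<forall>\<^sub>F n in sequentially. central_moment p (\<xi> n \<omega>) \<le> ennreal (2 * exp (\<delta> * real n)))"
proof -
  define L where "L e = e2ennreal (ext_log (normalized_moment p e))" for e
  have [measurable]: "ext_log \<in> borel_measurable borel"
    unfolding ext_log_def[abs_def] by measurable
  have L [measurable]: "L \<in> borel_measurable E"
    unfolding L_def[abs_def] by measurable
  note [measurable] = env_measurable
  have "(\<integral>\<^sup>+\<omega>. L (\<xi> 0 \<omega>) \<partial>M) = (\<integral>\<^sup>+\<omega>. e2ennreal (ext_log (quenched_moment M E \<xi> offspring X p \<omega>)) \<partial>M)"
    using quenched_moment_eq[of p] by (intro nn_integral_cong_AE) (auto simp: L_def elim!: eventually_mono)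
  then have Lfin: "(\<integral>\<^sup>+\<omega>. L (\<xi> 0 \<omega>) \<partial>M) < \<infinity>"
    using fin by (simp add: expect_log_finite_def)
  \<comment> \<open>The factor 2 absorbs the 1 lost in passing from the normalized to the central
    moment, as \<open>exp r\<close> is at least 1.\<close>
  have bound: "central_moment p e \<le> ennreal (2 * exp r)" if "L e \<le> ennreal r" "0 \<le> r" for e r
  proof -
    have "central_moment p e \<le> normalized_moment p e + 1" by (rule central_moment_le[OF p])
    also have "\<dots> \<le> ennreal (exp r) + ennreal 1"
      using le_exp_of_ext_log_le[of "normalized_moment p e" r] that
      by (intro add_mono) (auto simp: L_def)
    also have "\<dots> = ennreal (exp r + 1)" by (rule ennreal_plus[symmetric]) auto
    also have "\<dots> \<le> ennreal (2 * exp r)"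
      using that by (intro ennreal_leI) simp
    finally show ?thesis .
  qed
  have "AE \<omega> in M. L (\<xi> n \<omega>) \<noteq> \<infinity>" for n
    using Lfin nn_integral_env_stationary[OF L, of n] by (intro nn_integral_noteq_infinite) auto
  then have "AE \<omega> in M. \<forall>n. L (\<xi> n \<omega>) \<noteq> \<infinity>"
    by (simp add: AE_all_countable)
  with env_eventually_le_linear[OF L Lfin \<delta>] show ?thesis
  proof eventually_elim
    case (elim \<omega>)
    have "central_moment p (\<xi> n \<omega>) < \<infinity>" for n
    proof -
      obtain r where "0 \<le> r" "L (\<xi> n \<omega>) = ennreal r"
        using elim(2) by (cases "L (\<xi> n \<omega>)") auto
      then have "central_moment p (\<xi> n \<omega>) \<le> ennreal (2 * exp r)" by (intro bound) auto
      then show ?thesis by (simp add: le_less_trans)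
    qed
    moreover have "\<forall>\<^sub>F n in sequentially. central_moment p (\<xi> n \<omega>) \<le> ennreal (2 * exp (\<delta> * real n))"
      using elim(1) by (rule eventually_mono) (use \<delta> bound in auto)
    ultimately show ?case by blast
  qed
qed

lemma ln_BP_Pi: "\<omega> \<in> space M \<Longrightarrow> ln (BP_Pi offspring \<xi> n \<omega>) = (\<Sum>i<n. ln (BP_m offspring \<xi> i \<omega>))"
  unfolding BP_Pi_def using BP_m_pos by (intro ln_prod) (auto simp: less_imp_neq[symmetric])

text \<open>Subtracting the mean less \<delta> from the log means leaves a sequence of mean \<delta>
  > 0, whose partial sums are bounded below.\<close>

lemma BP_Pi_lower_bound:
  assumes int: "integrable M (\<lambda>\<omega>. ln (BP_m offspring \<xi> 0 \<omega>))" and \<delta>: "0 < \<delta>"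
  shows "AE \<omega> in M. \<exists>c. \<forall>n. c + real n * ((\<integral>\<omega>. ln (BP_m offspring \<xi> 0 \<omega>) \<partial>M) - \<delta>)
    \<le> ln (BP_Pi offspring \<xi> n \<omega>)"
proof -
  let ?l = "\<integral>\<omega>. ln (BP_m offspring \<xi> 0 \<omega>) \<partial>M"
  define g where "g e = ln (measure_pmf.expectation (offspring e) real) - (?l - \<delta>)" for e
  have g: "g \<in> borel_measurable E" unfolding g_def[abs_def] by measurable
  have g_eq: "g (\<xi> n \<omega>) = ln (BP_m offspring \<xi> n \<omega>) - (?l - \<delta>)" for n \<omega>
    by (simp add: g_def BP_m_def)
  have "AE \<omega> in M. \<exists>c. \<forall>n. c \<le> (\<Sum>i<n. g (\<xi> i \<omega>))"
    using int \<delta> by (intro ergodic_sums_bounded_below g) (simp_all add: g_eq prob_space)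
  with AE_space show ?thesis
  proof eventually_elim
    case (elim \<omega>)
    then obtain c where c: "\<And>n. c \<le> (\<Sum>i<n. g (\<xi> i \<omega>))" by blast
    have "c + real n * (?l - \<delta>) \<le> ln (BP_Pi offspring \<xi> n \<omega>)" for n
      using c[of n] by (simp add: ln_BP_Pi[OF elim(1)] g_eq sum_subtractf)
    then show ?case by blast
  qed
qed

text \<open>The weighted increments have quenched moments bounded by \<open>B n\<close>, and
  \<open>B n\<close> decays geometrically along almost every environment. The condition on
  \<open>s\<close> says \<open>s < 1 / q\<close>.\<close>

lemma BP_W_increment_series_finite:
  assumes int: "integrable M (\<lambda>\<omega>. ln (BP_m offspring \<xi> 0 \<omega>))"
    and l: "l = (\<integral>\<omega>. ln (BP_m offspring \<xi> 0 \<omega>) \<partial>M)" "0 < l"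
    and p: "1 < p" "p < 2" and fin: "expect_log_finite M (quenched_moment M E \<xi> offspring X p)"
    and s: "s * p < p - 1"
  shows "AE \<omega> in M. (\<Sum>n. ennreal (exp (s * p * l * real n)
    * \<bar>BP_W offspring \<xi> X (Suc n) \<omega> - BP_W offspring \<xi> X n \<omega>\<bar> powr p)) < \<infinity>"
proof -
  let ?w = "\<lambda>n. exp (s * p * l * real n)"
  let ?\<Delta> = "\<lambda>n \<omega>. \<bar>BP_W offspring \<xi> X (Suc n) \<omega> - BP_W offspring \<xi> X n \<omega>\<bar> powr p"
  define B where "B n \<omega> = ennreal (?w n) * (6 * (ennreal (BP_Pi offspring \<xi> n \<omega> powr (1 - p)) * central_moment p (\<xi> n \<omega>)))"
    for n \<omega>
  define D where "D n \<omega> = ennreal (?w n * ?\<Delta> n \<omega>)" for n \<omega>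
  \<comment> \<open>The exponent loses \<open>(p - 1) * \<delta>\<close> through the bound on
    \<open>\<Pi> n\<close> and \<delta> through the central moment, in total
    \<open>p * \<delta>\<close>. This choice spends half of the available gap
    \<open>(p - 1 - s * p) * l\<close>; the other half is \<kappa>.\<close>
  define \<delta> where "\<delta> = (p - 1 - s * p) * l / (2 * p)"
  have \<delta>: "0 < \<delta>" unfolding \<delta>_def using s l p by simp
  define \<kappa> where "\<kappa> = (p - 1 - s * p) * l / 2"
  have \<kappa>: "0 < \<kappa>" unfolding \<kappa>_def using s l by simp
  have "0 < p" using p by simp
  note [measurable] = measurable_from_env[OF measurable_BP_Pi]
  have W [measurable]: "BP_W offspring \<xi> X n \<in> borel_measurable M" for n
    unfolding BP_W_def[abs_def] by measurable
  have "AE \<omega> in M. (\<Sum>n. D n \<omega>) < \<infinity>"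
  proof (rule AE_suminf_finite_of_subalgebra_bound[OF env_subalgebra])
    show "finite_measure M" by unfold_locales
    show "D n \<in> borel_measurable M" for n unfolding D_def[abs_def] by measurable
    show "B n \<in> borel_measurable \<F>" for n unfolding B_def[abs_def] by measurable
    show "(\<integral>\<^sup>+\<omega>. h \<omega> * D n \<omega> \<partial>M) \<le> (\<integral>\<^sup>+\<omega>. h \<omega> * B n \<omega> \<partial>M)" if [measurable]: "h \<in> borel_measurable \<F>" for n h
    proof -
      have "(\<lambda>\<omega>. h \<omega> * ennreal (?w n)) \<in> borel_measurable \<F>" by measurable
      from nn_integral_BP_W_increment_le[OF p this, of n] show ?thesis
        by (simp add: D_def B_def ennreal_mult mult.assoc)
    qed
    show "AE \<omega> in M. (\<Sum>n. B n \<omega>) < \<infinity>"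
      using AE_space env_log_moment[OF fin \<open>0 < p\<close> \<delta>] BP_Pi_lower_bound[OF int \<delta>]
    proof eventually_elim
      case (elim \<omega>)
      from elim(3) obtain c where c: "\<And>n. c + real n * (l - \<delta>) \<le> ln (BP_Pi offspring \<xi> n \<omega>)"
        unfolding l by blast
      have Bfin: "B n \<omega> = ennreal (enn2real (B n \<omega>))" for n
        using elim(2) p by (simp add: B_def ennreal_mult_less_top)
      have ev: "\<forall>\<^sub>F n in sequentially. norm (enn2real (B n \<omega>)) \<le> 12 * exp ((1 - p) * c) * exp (- \<kappa>) ^ n"
      proof -
        have "\<forall>\<^sub>F n in sequentially. central_moment p (\<xi> n \<omega>) \<le> ennreal (2 * exp (\<delta> * real n))"
          using elim(2) p by simp
        then show ?thesis
        proof eventually_elim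
          case (elim n)
          have "BP_Pi offspring \<xi> n \<omega> powr (1 - p) = exp ((1 - p) * ln (BP_Pi offspring \<xi> n \<omega>))"
            using BP_Pi_pos[OF \<open>\<omega> \<in> space M\<close>, of n] by (simp add: powr_def)
          \<comment> \<open>As \<open>1 - p\<close> is negative, the lower bound on
            \<open>\<Pi> n\<close> becomes an upper bound.\<close>
          also have "\<dots> \<le> exp ((1 - p) * (c + real n * (l - \<delta>)))"
            using c[of n] p by (simp add: mult_left_mono_neg)
          finally have "ennreal (BP_Pi offspring \<xi> n \<omega> powr (1 - p)) \<le> ennreal (exp ((1 - p) * (c + real n * (l - \<delta>))))"
            by (rule ennreal_leI)
          with elim have "B n \<omega> \<le> ennreal (?w n) * (6 * (ennreal (exp ((1 - p) * (c + real n * (l - \<delta>)))) * ennreal (2 * exp (\<delta> * real n))))"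
            unfolding B_def by (intro mult_left_mono mult_mono) auto
          also have "\<dots> = ennreal (?w n * (6 * (exp ((1 - p) * (c + real n * (l - \<delta>))) * (2 * exp (\<delta> * real n)))))"
            by (simp add: ennreal_mult mult.left_commute[of _ 2])
          also have "?w n * (6 * (exp ((1 - p) * (c + real n * (l - \<delta>))) * (2 * exp (\<delta> * real n))))
              = 12 * exp (s * p * l * real n + (1 - p) * (c + real n * (l - \<delta>)) + \<delta> * real n)"
            by (simp add: exp_add)
          also have "s * p * l * real n + (1 - p) * (c + real n * (l - \<delta>)) + \<delta> * real n
              = (1 - p) * c + real n * (s * p * l + (1 - p) * l + p * \<delta>)"
            by (simp add: algebra_simps)
          also have "s * p * l + (1 - p) * l + p * \<delta> = - \<kappa>"
            using p by (simp add: \<delta>_def \<kappa>_def field_simps)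
          also have "12 * exp ((1 - p) * c + real n * - \<kappa>) = 12 * exp ((1 - p) * c) * exp (- \<kappa>) ^ n"
            by (simp only: exp_add exp_of_nat_mult mult.assoc)
          finally have "enn2real (B n \<omega>) \<le> 12 * exp ((1 - p) * c) * exp (- \<kappa>) ^ n"
            by (intro enn2real_leI) auto
          then show ?case by simp
        qed
      qed
      have "summable (\<lambda>n. 12 * exp ((1 - p) * c) * exp (- \<kappa>) ^ n)"
        using \<kappa> by (intro summable_mult summable_geometric) simp
      then have "summable (\<lambda>n. enn2real (B n \<omega>))"
        by (rule summable_comparison_test_ev[OF ev])
      then have "(\<Sum>n. ennreal (enn2real (B n \<omega>))) = ennreal (\<Sum>n. enn2real (B n \<omega>))"
        by (intro suminf_ennreal2) auto
      then have "(\<Sum>n. B n \<omega>) = ennreal (\<Sum>n. enn2real (B n \<omega>))"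
        using Bfin by simp
      then show ?case by simp
    qed
  qed
  then show ?thesis unfolding D_def .
qed

end

theorem theorem1p1:
  fixes M :: "'a measure" and E :: "'e measure"
    and \<xi> :: "nat \<Rightarrow> 'a \<Rightarrow> 'e"
    and offspring :: "'e \<Rightarrow> nat pmf"
    and X :: "nat \<Rightarrow> nat \<Rightarrow> 'a \<Rightarrow> nat"
    and p q m \<epsilon> :: real
  assumes "branching_process_random_env M E \<xi> offspring X"
    and "integrable M (\<lambda>\<omega>. ln (BP_m offspring \<xi> 0 \<omega>))"
    and "0 < (\<integral>\<omega>. ln (BP_m offspring \<xi> 0 \<omega>) \<partial>M)"
    and "m = exp (\<integral>\<omega>. ln (BP_m offspring \<xi> 0 \<omega>) \<partial>M)"
    and "1 < p" and "p < 2"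
    and "1 / p + 1 / q = 1"
    and "expect_log_finite M (quenched_moment M E \<xi> offspring X p)"
    and "0 < \<epsilon>"
  shows "AE \<omega> in M.
           (\<lambda>n. BP_W_lim offspring \<xi> X \<omega> - BP_W offspring \<xi> X n \<omega>)
             \<in> o(\<lambda>n. m powr (- (real n / (q + \<epsilon>))))"
proof -
  interpret branching_process_random_env M E \<xi> offspring X by fact
  define l where "l = (\<integral>\<omega>. ln (BP_m offspring \<xi> 0 \<omega>) \<partial>M)"
  have l: "0 < l" using assms by (simp add: l_def)
  have q_inv: "1 / q = 1 - 1 / p" using assms by simp
  have "0 < 1 / q" unfolding q_inv using assms by simp
  \<comment> \<open>The conjugacy relation alone fixes the sign of \<open>q\<close>.\<close>
  then have q: "0 < q" by (simp only: zero_less_divide_1_iff)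
  have "1 / (q + \<epsilon>) < 1 / q" using q assms by (simp add: field_simps)
  \<comment> \<open>The gap opened by \<epsilon> is split at \<open>s\<close>: the increments decay
    at the rate \<open>r = m powr (- s)\<close>, which is strictly faster than the target rate
    \<open>t = m powr (- 1 / (q + \<epsilon>))\<close>.\<close>
  then obtain s where s: "1 / (q + \<epsilon>) < s" "s < 1 / q" using dense by blast
  have "0 < 1 / (q + \<epsilon>)" using q assms by simp
  with s have s0: "0 < s" by linarith
  have "s * p < 1 / q * p" using s assms by (intro mult_strict_right_mono) auto
  also have "\<dots> = p - 1" using assms unfolding q_inv by (simp add: field_simps)
  finally have sp: "s * p < p - 1" .
  define r where "r = exp (- (s * l))"
  have r: "0 < r" "r < 1" using s0 l by (simp_all add: r_def)
  define t where "t = exp (- (l / (q + \<epsilon>)))"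
  have rt: "r < t" "0 < t"
    using mult_strict_right_mono[OF s(1) l] by (simp_all add: r_def t_def)
  have t_eq: "m powr (- (real n / (q + \<epsilon>))) = t ^ n" for n
    using assms by (simp add: t_def l_def powr_def exp_of_nat_mult[symmetric])
  have "(\<lambda>n. r ^ n / t ^ n) \<longlonglongrightarrow> 0"
    using r rt LIMSEQ_realpow_zero[of "r / t"] by (simp add: power_divide)
  then have small: "(\<lambda>n. r ^ n) \<in> o(\<lambda>n. t ^ n)"
    using rt by (intro smalloI_tendsto) auto
  have "AE \<omega> in M. (\<Sum>n. ennreal (exp (s * p * l * real n)
    * \<bar>BP_W offspring \<xi> X (Suc n) \<omega> - BP_W offspring \<xi> X n \<omega>\<bar> powr p)) < \<infinity>"
    using assms l sp by (intro BP_W_increment_series_finite l_def) auto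
  then show ?thesis
  proof eventually_elim
    case (elim \<omega>)
    let ?W = "\<lambda>n. BP_W offspring \<xi> X n \<omega>"
    have "summable (\<lambda>n. exp (s * p * l * real n) * \<bar>?W (Suc n) - ?W n\<bar> powr p)"
      using elim by (intro summable_suminf_not_top) auto
    then have "(\<lambda>n. exp (s * p * l * real n) * \<bar>?W (Suc n) - ?W n\<bar> powr p) \<longlonglongrightarrow> 0"
      by (rule summable_LIMSEQ_zero)
    then have "\<forall>\<^sub>F n in sequentially. exp (s * p * l * real n) * \<bar>?W (Suc n) - ?W n\<bar> powr p < 1"
      by (rule order_tendstoD) simp
    \<comment> \<open>The weight is the reciprocal of \<open>(r ^ n) powr p\<close>, so an increment
      above \<open>r ^ n\<close> would make the corresponding term exceed 1.\<close>
    then have "\<forall>\<^sub>F n in sequentially. \<bar>?W (Suc n) - ?W n\<bar> \<le> r ^ n"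
    proof eventually_elim
      case (elim n)
      show ?case
      proof (rule ccontr)
        assume "\<not> ?thesis"
        then have "(r ^ n) powr p < \<bar>?W (Suc n) - ?W n\<bar> powr p"
          using r assms by (intro powr_less_mono2) auto
        moreover have "(r ^ n) powr p = exp (- (s * p * l * real n))"
          using r by (simp add: powr_def ln_realpow) (simp add: r_def mult_ac)
        ultimately have "exp (s * p * l * real n) * exp (- (s * p * l * real n))
            < exp (s * p * l * real n) * \<bar>?W (Suc n) - ?W n\<bar> powr p"
          by (intro mult_strict_left_mono) auto
        with elim show False by (simp add: exp_minus)
      qed
    qed
    then obtain N where "\<And>n. N \<le> n \<Longrightarrow> \<bar>?W (Suc n) - ?W n\<bar> \<le> r ^ n"
      by (auto simp: eventually_sequentially)
    then have "\<bar>lim ?W - ?W n\<bar> \<le> r ^ n / (1 - r)" if "N \<le> n" for n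
      using r that by (intro abs_lim_diff_le_geometric) auto
    then have "\<forall>\<^sub>F n in sequentially. norm (lim ?W - ?W n) \<le> 1 / (1 - r) * norm (r ^ n)"
      using r by (auto simp: eventually_sequentially intro!: exI[of _ N])
    then have "(\<lambda>n. lim ?W - ?W n) \<in> O(\<lambda>n. r ^ n)"
      by (rule bigoI)
    from landau_o.big_small_trans[OF this small] show ?case
      by (simp add: BP_W_lim_def t_eq)
  qed
qed

end
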